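(* Let $\sigma>0$, $\alpha\in\mathbb C$ with $\Re(\alpha)\ge0$, $\Im(\alpha)>0$, $\beta=\overline\alpha$, $\eta=\alpha\beta$. Consider the linear operator $\mathbb S$ in $\mathcal P(\mathbb C)$ given by $(\mathbb Ss_n)(z)=z^n$, $n\in\mathbb N_0$. It admits an extension to a continuous linear operator $\mathbb S$ in $\mathcal E^1_{\mathrm{min}}(\mathbb C)$, and for each $f\in\mathcal E^1_{\mathrm{min}}(\mathbb C)$ and $z\in\mathbb C$, $$(\mathbb Sf)(z)=\int_{\mathbb N_0}\int_{\mathbb R}f(x+\beta\xi)\,\mu_{\alpha,\beta,\eta\xi+\sigma}(dx)\,\pi_{\frac z\beta}(d\xi).$$ In particular, for each $r>0$, $$(\mathbb Sf)(\beta r)=\int_{\mathbb N_0}\int_{\mathbb R}f(x+\beta\xi)\,\mu_{\alpha,\beta,\eta\xi+\sigma}(dx)\,\pi_r(d\xi).$$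
   Context: $\mathbb N_0=\{0,1,2,\dots\}$; $\mathcal P(\mathbb C)$ is the space of complex polynomials. With $\lambda=\alpha+\beta$, $\eta=\alpha\beta$, $(s_n)_{n\ge0}$ is the monic polynomial sequence with $s_0=1$ and $zs_n(z)=s_{n+1}(z)+\lambda n\,s_n(z)+(\sigma n+\eta n(n-1))s_{n-1}(z)$ (Meixner polynomials of the second kind). For $\sigma>0$ the orthogonality measure of $(s_n)$ is the probability measure on $\mathbb R$ $$\mu_{\alpha,\beta,\sigma}(dx)=C_{\alpha,\beta,\sigma}\exp\Big(\frac{(\frac\pi2-\operatorname{Arg}(\alpha))x}{\Im(\alpha)}\Big)\Big|\Gamma\Big(\frac{ix}{2\Im(\alpha)}+\frac{i\sigma\beta}{2\eta\Im(\alpha)}\Big)\Big|^2dx,$$ where $\operatorname{Arg}(\alpha)\in(0,\pi/2]$ and $C_{\alpha,\beta,\sigma}=\frac{(2\cos(\frac\pi2-\operatorname{Arg}(\alpha)))^{\sigma/\eta}}{4\Im(\alpha)\pi\Gamma(\sigma/\eta)}\exp\big(\frac{(\frac\pi2-\operatorname{Arg}(\alpha))\sigma\Re(\alpha)}{\Im(\alpha)\eta}\big)$; $\mu_{\alpha,\beta,\eta\xi+\sigma}$ is obtained by replacing $\sigma$ with $\eta\xi+\sigma>0$ (with $\alpha,\beta,\eta$ unchanged). For $\zeta\in\mathbb C$, $\pi_\zeta=e^{-\zeta}\sum_{n\ge0}\frac{\zeta^n}{n!}\delta_n$ (complex-valued Poisson measure on $\mathbb N_0$). $\mathcal E^1_{\mathrm{min}}(\mathbb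 C)$ is the space of entire functions $\varphi$ with $\|\varphi\|_t=\sup_{z\in\mathbb C}|\varphi(z)|e^{-t|z|}<\infty$ for all $t>0$ (order at most 1 and minimal type), with the Fréchet topology defined by the norms $\|\cdot\|_t$, $t>0$. The operator $\mathbb S$ on $\mathcal P(\mathbb C)$ is the restriction of the generalized Segal–Bargmann transform, the unitary operator from $L^2(\mathbb R,\mu_{\alpha,\beta,\sigma})$ onto the Hilbert space of entire functions in which the monomials $z^n$ form an orthogonal basis with $\|z^n\|^2=n!\,\sigma(\sigma+\eta)\cdots(\sigma+(n-1)\eta)$, sending $s_n$ to $z^n$. *)

theory Defs
  imports "HOL-Complex_Analysis.Complex_Analysis" "HOL-Probability.Probability"
begin

fun meixner_poly :: "complex \<Rightarrow> complex \<Rightarrow> complex \<Rightarrow> nat \<Rightarrow> complex poly" where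
  "meixner_poly \<alpha> \<beta> \<sigma> 0 = 1"
| "meixner_poly \<alpha> \<beta> \<sigma> (Suc 0) = [:0, 1:]"
| "meixner_poly \<alpha> \<beta> \<sigma> (Suc (Suc n)) =
     [:- ((\<alpha> + \<beta>) * of_nat (Suc n)), 1:] * meixner_poly \<alpha> \<beta> \<sigma> (Suc n)
     - smult (\<sigma> * of_nat (Suc n) + \<alpha> * \<beta> * of_nat (Suc n) * of_nat n) (meixner_poly \<alpha> \<beta> \<sigma> n)"

lemma meixner_poly_recurrence:
  "[:0, 1:] * meixner_poly \<alpha> \<beta> \<sigma> n =
     meixner_poly \<alpha> \<beta> \<sigma> (Suc n)
     + smult ((\<alpha> + \<beta>) * of_nat n) (meixner_poly \<alpha> \<beta> \<sigma> n)
     + smult (\<sigma> * of_nat n + \<alpha> * \<beta> * of_nat n * (of_nat n - 1)) (meixner_poly \<alpha> \<beta> \<sigma> (n - 1))"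
  by (cases n) simp_all

text \<open>Below, \<open>\<eta> = \<alpha>\<beta>\<close> is real because the definitions are used with
  \<open>\<beta> = cnj \<alpha>\<close> only; it is therefore rendered as \<open>Re (\<alpha> * \<beta>)\<close>.\<close>

definition meixner_const :: "complex \<Rightarrow> complex \<Rightarrow> real \<Rightarrow> real" where
  "meixner_const \<alpha> \<beta> \<sigma> =
    (let \<eta> = Re (\<alpha> * \<beta>) in
      (2 * cos (pi / 2 - Arg \<alpha>)) powr (\<sigma> / \<eta>) / (4 * Im \<alpha> * pi * Gamma (\<sigma> / \<eta>))
      * exp ((pi / 2 - Arg \<alpha>) * \<sigma> * Re \<alpha> / (Im \<alpha> * \<eta>)))"

definition meixner_density :: "complex \<Rightarrow> complex \<Rightarrow> real \<Rightarrow> real \<Rightarrow> real" where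
  "meixner_density \<alpha> \<beta> \<sigma> x =
    (let \<eta> = Re (\<alpha> * \<beta>) in
      meixner_const \<alpha> \<beta> \<sigma> * exp ((pi / 2 - Arg \<alpha>) * x / Im \<alpha>)
      * (cmod (Gamma (\<i> * of_real x / of_real (2 * Im \<alpha>)
                      + \<i> * of_real \<sigma> * \<beta> / of_real (2 * \<eta> * Im \<alpha>))))\<^sup>2)"

definition meixner_measure :: "complex \<Rightarrow> complex \<Rightarrow> real \<Rightarrow> real measure" where
  "meixner_measure \<alpha> \<beta> \<sigma> = density lborel (\<lambda>x. ennreal (meixner_density \<alpha> \<beta> \<sigma> x))"

text \<open>The complex-valued measure \<open>\<pi>\<^sub>\<zeta>\<close> on the natural numbers is given by its point masses;
  integrability with respect to it means integrability with respect to its total variation,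
  i.e. absolute summability.\<close>

definition cpoisson_mass :: "complex \<Rightarrow> nat \<Rightarrow> complex" where
  "cpoisson_mass \<zeta> n = exp (- \<zeta>) * \<zeta> ^ n / fact n"

definition cpoisson_integrable :: "complex \<Rightarrow> (nat \<Rightarrow> complex) \<Rightarrow> bool" where
  "cpoisson_integrable \<zeta> g \<longleftrightarrow> integrable (count_space UNIV) (\<lambda>n. cpoisson_mass \<zeta> n * g n)"

definition cpoisson_integral :: "complex \<Rightarrow> (nat \<Rightarrow> complex) \<Rightarrow> complex" where
  "cpoisson_integral \<zeta> g = integral\<^sup>L (count_space UNIV) (\<lambda>n. cpoisson_mass \<zeta> n * g n)"

lemma cpoisson_integral_of_real:
  assumes "r > 0"
  shows "cpoisson_integral (of_real r) g = measure_pmf.expectation (poisson_pmf r) g"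
proof -
  have "cpoisson_mass (of_real r) n * g n = pmf (poisson_pmf r) n *\<^sub>R g n" for n
    using assms
    by (simp add: cpoisson_mass_def scaleR_conv_of_real flip: exp_of_real)
  then show ?thesis
    by (simp add: cpoisson_integral_def measure_pmf_eq_density integral_density)
qed

text \<open>\<open>Emin_norm t f\<close> is meaningful only if the supremum is over a bounded set, which is part of
  the definition of \<open>Emin\<close>.\<close>

definition Emin_norm :: "real \<Rightarrow> (complex \<Rightarrow> complex) \<Rightarrow> real" where
  "Emin_norm t f = (SUP z. cmod (f z) * exp (- t * cmod z))"

definition Emin :: "(complex \<Rightarrow> complex) set" where
  "Emin = {f. f holomorphic_on UNIV \<and>
              (\<forall>t>0. bdd_above (range (\<lambda>z. cmod (f z) * exp (- t * cmod z))))}"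

definition Emin_topology :: "(complex \<Rightarrow> complex) topology" where
  "Emin_topology = topology_generated_by
     {{g \<in> Emin. Emin_norm t (\<lambda>z. g z - f z) < e} | f t e. f \<in> Emin \<and> t > 0 \<and> e > 0}"

definition linear_on_Emin :: "((complex \<Rightarrow> complex) \<Rightarrow> (complex \<Rightarrow> complex)) \<Rightarrow> bool" where
  "linear_on_Emin T \<longleftrightarrow>
     T ` Emin \<subseteq> Emin \<and>
     (\<forall>f\<in>Emin. \<forall>g\<in>Emin. T (\<lambda>z. f z + g z) = (\<lambda>z. T f z + T g z)) \<and>
     (\<forall>c. \<forall>f\<in>Emin. T (\<lambda>z. c * f z) = (\<lambda>z. c * T f z))"

lemma topspace_Emin_topology: "topspace Emin_topology = Emin"
proof -
  have "Emin_norm 1 (\<lambda>z. f z - f z) < 1" for f :: "complex \<Rightarrow> complex"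
    by (simp add: Emin_norm_def)
  then have "f \<in> \<Union> {{g \<in> Emin. Emin_norm t (\<lambda>z. g z - f z) < e} | f t e.
                  f \<in> Emin \<and> t > 0 \<and> e > 0}" if "f \<in> Emin" for f
    using that
    by (intro UnionI[of "{g \<in> Emin. Emin_norm 1 (\<lambda>z. g z - f z) < 1}"] CollectI exI[of _ f]
          exI[of _ 1] exI[of _ "1::real"]) auto
  then show ?thesis
    unfolding Emin_topology_def topology_generated_by_topspace by blast
qed

lemma meixner_poly_degree:
  "degree (meixner_poly \<alpha> \<beta> \<sigma> n) = n \<and> lead_coeff (meixner_poly \<alpha> \<beta> \<sigma> n) = 1"
proof (induction n rule: induct_nat_012)
  case (ge2 n)
  let ?p = "meixner_poly \<alpha> \<beta> \<sigma> (Suc n)"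
  let ?A = "[:- ((\<alpha> + \<beta>) * of_nat (Suc n)), 1:] * ?p"
  let ?B = "smult (\<sigma> * of_nat (Suc n) + \<alpha> * \<beta> * of_nat (Suc n) * of_nat n)
              (meixner_poly \<alpha> \<beta> \<sigma> n)"
  have "?p \<noteq> 0"
    using ge2 by auto
  then have A: "degree ?A = Suc (Suc n)"
    using ge2 by (subst degree_mult_eq) auto
  have lA: "lead_coeff ?A = 1"
  proof -
    have "coeff ?p (Suc n) = 1" "degree ?p = Suc n"
      using ge2 by auto
    then show ?thesis
      by (simp only: lead_coeff_mult) simp
  qed
  have B: "degree ?B < degree ?A"
    using ge2 A by (intro le_less_trans[OF degree_smult_le]) simp
  have "degree (?A - ?B) = degree ?A"
    using degree_add_eq_left[of "- ?B" ?A] B by simp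
  moreover have "lead_coeff (?A - ?B) = 1"
    using lA calculation coeff_eq_0[OF B] by (simp only: coeff_diff diff_0_right)
  ultimately show ?case
    using A by (simp only: meixner_poly.simps) 
qed auto

lemma meixner_poly_operator_ex1:
  "\<exists>!S. Vector_Spaces.linear smult smult S \<and> (\<forall>n. S (meixner_poly \<alpha> \<beta> \<sigma> n) = monom 1 n)"
proof -
  interpret vs: vector_space "smult :: complex \<Rightarrow> _"
    by unfold_locales (simp_all add: smult_add_right smult_add_left)
  interpret vp: vector_space_pair "smult :: complex \<Rightarrow> _" "smult :: complex \<Rightarrow> _"
    by unfold_locales
  let ?s = "meixner_poly \<alpha> \<beta> \<sigma>"
  have deg: "degree (?s n) = n" and lead: "coeff (?s n) n = 1" for n
    using meixner_poly_degree[of \<alpha> \<beta> \<sigma> n] by auto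
  have inj: "inj ?s"
    by (metis deg injI)
  have span: "p \<in> vs.span (range ?s)" for p
  proof (induction "degree p" arbitrary: p rule: less_induct)
    case less
    define q where "q = p - smult (lead_coeff p) (?s (degree p))"
    have 0: "coeff q (degree p) = 0"
      by (simp add: q_def lead)
    have le: "degree q \<le> degree p"
      unfolding q_def by (rule degree_diff_le) (auto simp: deg intro: order_trans[OF degree_smult_le])
    have "q \<in> vs.span (range ?s)"
    proof (cases "q = 0")
      case False
      then have "degree q < degree p"
        using 0 le by (metis leading_coeff_0_iff le_neq_implies_less)
      then show ?thesis using less by blast
    qed (simp add: vs.span_zero)
    moreover have "p = q + smult (lead_coeff p) (?s (degree p))"
      by (simp add: q_def)
    ultimately show ?case
      by (metis vs.span_add vs.span_scale vs.span_base rangeI)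
  qed
  have indep: "vs.independent (range ?s)"
  proof
    assume "vs.dependent (range ?s)"
    then obtain T u where T: "finite T" "T \<subseteq> range ?s" "(\<Sum>v\<in>T. smult (u v) v) = 0"
      and ex: "\<exists>v\<in>T. u v \<noteq> 0"
      unfolding vs.dependent_explicit by blast
    define N where "N = {n. ?s n \<in> T \<and> u (?s n) \<noteq> 0}"
    have "finite (?s -` T)"
      using T inj by (simp add: finite_vimageI)
    then have fin: "finite N"
      by (rule finite_subset[rotated]) (auto simp: N_def)
    have ne: "N \<noteq> {}" using ex T by (auto simp: N_def)
    define m where "m = Max N"
    have m: "m \<in> N" using fin ne by (simp add: m_def)
    have z: "u v * coeff v m = 0" if v: "v \<in> T - {?s m}" for v
    proof -
      obtain k where k: "v = ?s k" using v T(2) by blast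
      show ?thesis
      proof (cases "u v = 0")
        case False
        then have "k \<in> N" using v k by (auto simp: N_def)
        then have "k \<le> m" using fin by (simp add: m_def)
        then have "k < m" using v k by (cases "k = m") auto
        then show ?thesis using k by (simp add: coeff_eq_0 deg)
      qed simp
    qed
    have "0 = coeff (\<Sum>v\<in>T. smult (u v) v) m" using T by simp
    also have "\<dots> = (\<Sum>v\<in>T. u v * coeff v m)" by (simp add: coeff_sum)
    also have "\<dots> = u (?s m) * coeff (?s m) m + (\<Sum>v\<in>T - {?s m}. u v * coeff v m)"
      using m T by (intro sum.remove) (auto simp: N_def)
    also have "\<dots> = u (?s m)" by (simp only: sum.neutral[OF ballI[OF z]] lead) simp
    finally show False using m by (simp add: N_def)
  qed
  obtain S where S: "Vector_Spaces.linear smult smult S"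
    and Sb: "\<forall>x\<in>range ?s. S x = monom 1 (degree x)"
    using vp.linear_independent_extend[OF indep, of "\<lambda>x. monom 1 (degree x)"] by blast
  show ?thesis
  proof (rule ex1I[of _ S])
    show "Vector_Spaces.linear smult smult S \<and> (\<forall>n. S (?s n) = monom 1 n)"
      using S Sb by (simp add: deg)
  next
    fix T assume T: "Vector_Spaces.linear smult smult T \<and> (\<forall>n. T (?s n) = monom 1 n)"
    show "T = S"
    proof
      fix p show "T p = S p"
        by (rule vp.linear_eq_on[of T S p "range ?s"]) (use T S Sb span in \<open>auto simp: deg\<close>)
    qed
  qed
qed

end

theory Submission
  imports Defs
begin

unbundle no vec_syntax

text \<open>
  Rotating the Gamma integral gives
  \<open>e\<^bsup>\<theta>y\<^esup> |\<Gamma>(p + iy)|\<close> as the modulus of the Fourier transform of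
  \<open>s \<mapsto> exp (ps - e\<^bsup>s + i\<theta>\<^esup>)\<close>, so Plancherel's formula evaluates
  \<open>\<integral> e\<^bsup>2\<theta>y\<^esup> |\<Gamma>(p + iy)|\<^sup>2 dy\<close>. This is the Laplace transform of the Meixner measure;
  it is a power \<open>laplace u\<^bsup>\<kappa> + n\<^esup>\<close> in the index \<open>n\<close>, and integrating over the Poisson weights yields
  \<open>h(u) e\<^bsup>z t(u)\<^esup>\<close> for the image of \<open>e\<^bsup>ux\<^esup>\<close>, where \<open>t' = (1 + \<alpha>t)(1 + \<beta>t)\<close> and \<open>h' = \<sigma>th\<close>.
  On the other hand \<open>\<S>\<close> intertwines multiplication by the variable with the operator
  \<open>A = z(1 + \<alpha>\<partial>)(1 + \<beta>\<partial>) + \<sigma>\<partial>\<close> (three-term recurrence), so \<open>\<S> z\<^sup>k = A\<^sup>k 1\<close>, and the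
  differential equations of \<open>t\<close> and \<open>h\<close> say that these polynomials have exactly that generating
  function. Hence both sides of the formula agree on polynomials. The bound
  \<open>|A\<^sup>k 1 (z)| \<le> k! K\<^sub>\<tau>\<^sup>k e\<^bsup>\<tau>|z|\<^esup>\<close>, valid for every \<open>\<tau> > 0\<close>, together with Cauchy's estimate for the
  Taylor coefficients gives the continuity on the space of entire functions of minimal type, and
  dominated convergence extends the formula from polynomials to their power series.
\<close>

section \<open>The Gamma integral along a ray\<close>

lemma has_bochner_integral_lebesgue_imp_lborel:
  fixes f :: "real \<Rightarrow> 'a :: euclidean_space"
  assumes "f \<in> borel_measurable borel" "f absolutely_integrable_on UNIV" "integral UNIV f = x"
  shows "has_bochner_integral lborel f x"
proof -
  have "integrable lebesgue f"
    using assms(2) by (simp add: set_integrable_def)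
  then have "integrable lborel f"
    using assms(1) by (simp add: integrable_completion)
  then show ?thesis
    using assms(3) integral_lborel[of f] by (simp add: has_bochner_integral_iff)
qed

lemma sum_exp_series_le:
  fixes x :: real
  assumes "x \<ge> 0"
  shows "(\<Sum>n<N. x ^ n /\<^sub>R fact n) \<le> exp x"
proof -
  have "(\<lambda>n. x ^ n /\<^sub>R fact n) sums exp x" by (rule exp_converges)
  then show ?thesis
    using sum_le_suminf[of "\<lambda>n. x ^ n /\<^sub>R fact n" "{..<N}"] assms by (auto simp: sums_iff)
qed

text \<open>The substitution t = e^s moves Euler's integral to the whole line. There Im z enters
  only through the factor e^(i s Im z), so along a vertical line Gamma is a Fourier
  transform.\<close>

lemma has_bochner_integral_Gamma_exp:
  fixes z :: complex
  assumes z: "Re z > 0"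
  shows "has_bochner_integral lborel (\<lambda>s::real. exp (z * of_real s - of_real (exp s))) (Gamma z)"
proof -
  let ?f = "\<lambda>t. complex_of_real t powr (z - 1) / of_real (exp t)"
  have img: "range (exp :: real \<Rightarrow> real) = {0<..}"
    by (auto simp: image_iff) (metis exp_ln)
  have eq: "\<bar>exp s\<bar> *\<^sub>R ?f (exp s) = exp (z * of_real s - of_real (exp s))" for s :: real
    by (simp add: powr_def scaleR_conv_of_real exp_diff algebra_simps
          flip: exp_of_real Ln_of_real)
  have "(\<lambda>s. \<bar>exp s\<bar> *\<^sub>R ?f (exp s)) absolutely_integrable_on UNIV \<and>
        integral UNIV (\<lambda>s. \<bar>exp s\<bar> *\<^sub>R ?f (exp s)) = Gamma z"
    by (subst has_absolute_integral_change_of_variables_real)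
       (use absolutely_integrable_Gamma_integral'[OF z] Gamma_integral_complex'[OF z] in
         \<open>auto simp: img integral_unique inj_on_def intro!: derivative_eq_intros\<close>)
  then show ?thesis
    unfolding eq by (intro has_bochner_integral_lebesgue_imp_lborel) auto
qed

text \<open>Scaling the variable of Euler's integral by \<open>c\<close> is the translation of s by
  \<open>ln c\<close>, under which Lebesgue measure is invariant.\<close>

lemma has_bochner_integral_Gamma_exp_of_real:
  fixes z :: complex and c :: real
  assumes z: "Re z > 0" and c: "c > 0"
  shows "has_bochner_integral lborel (\<lambda>s::real. exp (z * of_real s - of_real (c * exp s)))
           (Gamma z * of_real c powr - z)"
proof -
  have eq: "exp (z * of_real (ln c + 1 * s) - of_real (exp (ln c + 1 * s))) =
     of_real c powr z * exp (z * of_real s - of_real (c * exp s))" for s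
    using c by (simp add: exp_add powr_def exp_diff algebra_simps flip: Ln_of_real)
  have "has_bochner_integral lborel
     (\<lambda>s. of_real c powr z * exp (z * of_real s - of_real (c * exp s))) (Gamma z)"
    using has_bochner_integral_Gamma_exp[OF z]
    by (subst (asm) lborel_has_bochner_integral_real_affine_iff[of 1 _ _ "ln c"])
       (simp_all add: eq[simplified])
  from has_bochner_integral_mult_right[OF this, of "of_real c powr - z"]
  show ?thesis
    using c by (simp add: powr_minus field_simps)
qed

text \<open>Every \<open>w\<close> in the right half-plane lies in a disc around some real \<open>c > 0\<close> of radius \<open>c\<close>;
  expanding \<open>exp (- w e\<^sup>s)\<close> around \<open>c\<close> turns the claim into the binomial series.\<close>

lemma has_bochner_integral_Gamma_exp_complex:
  fixes z w :: complex
  assumes z: "Re z > 0" and w: "Re w > 0"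
  shows "has_bochner_integral lborel (\<lambda>s::real. exp (z * of_real s - w * of_real (exp s)))
           (Gamma z * w powr - z)"
proof -
  \<comment> \<open>Since c Re w = |w|^2, this choice gives |w - c|^2 = c^2 - |w|^2, so w lies in
    the open disc of radius c about c.\<close>
  define c where "c = (cmod w)\<^sup>2 / Re w"
  have "w \<noteq> 0" using w by auto
  then have c: "c > 0" using w by (simp add: c_def)
  have wc: "(cmod w)\<^sup>2 = c * Re w" using w by (simp add: c_def)
  define d where "d = w - of_real c"
  have d: "cmod d < c"
  proof (rule power2_less_imp_less)
    have "(cmod d)\<^sup>2 = (cmod w)\<^sup>2 - 2 * c * Re w + c\<^sup>2"
      unfolding d_def cmod_power2 by (simp add: power2_eq_square algebra_simps)
    also have "\<dots> < c\<^sup>2" using w c by (simp add: wc)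
    finally show "(cmod d)\<^sup>2 < c\<^sup>2" .
  qed (use c in auto)
  define f where "f = (\<lambda>n s. (- d) ^ n / fact n *
      exp ((z + of_nat n) * of_real s - of_real (c * exp s)))"
  define J where "J = (\<lambda>n. (- d) ^ n / fact n * (Gamma (z + of_nat n) * of_real c powr - (z + of_nat n)))"
  have fJ: "has_bochner_integral lborel (f n) (J n)" for n
    unfolding f_def J_def
    by (intro has_bochner_integral_mult_right has_bochner_integral_Gamma_exp_of_real) (use z c in auto)
  let ?F = "\<lambda>s::real. exp (z * of_real s - w * of_real (exp s))"
  have f_eq: "f n s = exp (z * of_real s - of_real (c * exp s)) *
        ((- d * of_real (exp s)) ^ n /\<^sub>R fact n)" for n s
  proof -
    have "(of_real (exp s) :: complex) ^ n = exp (of_nat n * of_real s)"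
      by (simp add: exp_of_nat_mult exp_of_real)
    then have "exp ((z + of_nat n) * of_real s - of_real (c * exp s)) =
        exp (z * of_real s - of_real (c * exp s)) * of_real (exp s) ^ n"
      by (simp add: algebra_simps flip: exp_add)
    then show ?thesis
      unfolding f_def power_mult_distrib by (simp add: scaleR_conv_of_real field_simps)
  qed
  have fsums: "(\<lambda>n. f n s) sums ?F s" for s
  proof -
    have "(\<lambda>n. f n s) sums (exp (z * of_real s - of_real (c * exp s)) * exp (- d * of_real (exp s)))"
      unfolding f_eq by (intro sums_mult exp_converges)
    also have "exp (z * of_real s - of_real (c * exp s)) * exp (- d * of_real (exp s)) = ?F s"
      by (simp add: d_def algebra_simps flip: exp_add)
    finally show ?thesis .
  qed
  \<comment> \<open>Summing absolute values lowers the rate from c to c - |d|, which is still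
    positive, so \<open>g\<close> is the modulus of a Gamma integrand with a real rate.\<close>
  define g where "g = (\<lambda>s::real. exp (Re z * s - (c - cmod d) * exp s))"
  have bound: "norm (\<Sum>n<N. f n s) \<le> g s" for N s
  proof -
    have "norm (\<Sum>n<N. f n s) \<le> (\<Sum>n<N. norm (f n s))" by (rule norm_sum)
    also have "\<dots> = exp (Re z * s - c * exp s) * (\<Sum>n<N. (cmod d * exp s) ^ n /\<^sub>R fact n)"
      by (simp add: f_eq norm_mult norm_power norm_divide sum_distrib_left mult_ac)
    also have "\<dots> \<le> exp (Re z * s - c * exp s) * exp (cmod d * exp s)"
      by (intro mult_left_mono sum_exp_series_le) auto
    also have "\<dots> = g s"
      by (simp add: g_def algebra_simps flip: exp_add)
    finally show ?thesis .
  qed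
  have gint: "integrable lborel g"
  proof -
    have "has_bochner_integral lborel (\<lambda>s::real. exp (z * of_real s - of_real ((c - cmod d) * exp s)))
           (Gamma z * of_real (c - cmod d) powr - z)"
      using d by (intro has_bochner_integral_Gamma_exp_of_real z) auto
    then have "integrable lborel (\<lambda>s. norm (exp (z * of_real s - of_real ((c - cmod d) * exp s))))"
      by (intro integrable_norm) (auto simp: has_bochner_integral_iff)
    then show ?thesis by (simp add: g_def)
  qed
  have meas: "(\<lambda>s. \<Sum>n<N. f n s) \<in> borel_measurable lborel" for N
    unfolding f_def by measurable
  have dct: "integrable lborel ?F"
     "(\<lambda>N. \<integral>s. (\<Sum>n<N. f n s) \<partial>lborel) \<longlonglongrightarrow> (\<integral>s. ?F s \<partial>lborel)"
    using fsums bound gint meas unfolding sums_def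
    by (auto intro!: integrable_dominated_convergence[where w = g and s = "\<lambda>N s. \<Sum>n<N. f n s"]
          integral_dominated_convergence[where w = g and s = "\<lambda>N s. \<Sum>n<N. f n s"] AE_I2)
  have "(\<integral>s. (\<Sum>n<N. f n s) \<partial>lborel) = (\<Sum>n<N. J n)" for N
    using fJ by (subst Bochner_Integration.integral_sum) (auto simp: has_bochner_integral_iff)
  then have Jsums: "J sums (\<integral>s. ?F s \<partial>lborel)"
    using dct(2) by (simp add: sums_def)
  have zn: "z \<notin> \<int>\<^sub>\<le>\<^sub>0" using z by (auto elim!: nonpos_Ints_cases)
  \<comment> \<open>Gamma(z + n) / Gamma(z) is a rising factorial, that is (-1)^n n! times a
    binomial coefficient of -z; the sign cancels against that of (-d)^n.\<close>
  have J_eq: "J n = Gamma z * of_real c powr - z * ((- z gchoose n) * (d / of_real c) ^ n)" for n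
  proof -
    have "Gamma (z + of_nat n) = pochhammer z n * Gamma z"
      using zn by (simp add: pochhammer_Gamma Gamma_eq_zero_iff)
    moreover have "of_real c powr - (z + of_nat n) = of_real c powr - z / of_real c ^ n"
      using c by (simp add: powr_diff powr_nat')
    ultimately show ?thesis
      by (simp add: J_def gbinomial_pochhammer power_minus[of d] power_divide mult_ac)
  qed
  have "J sums (Gamma z * of_real c powr - z * (1 + d / of_real c) powr - z)"
    unfolding J_eq
    by (intro sums_mult gen_binomial_complex) (use d c in \<open>simp add: norm_divide\<close>)
  also have "1 + d / of_real c = w / of_real c" using c by (simp add: d_def field_simps)
  also have "Gamma z * of_real c powr - z * (w / of_real c) powr - z = Gamma z * w powr - z"
  proof -
    have "w / of_real c \<noteq> 0" using w c by auto
    then have "Ln (of_real c * (w / of_real c)) = of_real (ln c) + Ln (w / of_real c)"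
      using Ln_times_of_real[OF c \<open>w / of_real c \<noteq> 0\<close>] Ln_of_real[OF c] by simp
    moreover have "of_real c * (w / of_real c) = w" using c by simp
    ultimately have "Ln w = of_real (ln c) + Ln (w / of_real c)" by simp
    moreover have "w \<noteq> 0" using w by auto
    ultimately show ?thesis
      using c by (simp add: powr_def Ln_of_real algebra_simps exp_diff exp_minus divide_simps)
  qed
  finally have "(\<integral>s. ?F s \<partial>lborel) = Gamma z * w powr - z"
    using Jsums sums_unique2 by blast
  with dct(1) show ?thesis by (simp add: has_bochner_integral_iff)
qed

section \<open>Plancherel\<close>

lemma cnj_measurable [measurable]: "cnj \<in> borel_measurable borel"
  by (intro borel_measurable_continuous_onI continuous_intros)

text \<open>Sign and normalisation are those of a characteristic function, so the Gaussian case can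
  be taken from \<open>char_std_normal_distribution\<close>; they also cause the factor 2 pi in
  \<open>plancherel\<close>.\<close>

definition fourier :: "(real \<Rightarrow> complex) \<Rightarrow> real \<Rightarrow> complex" where
  "fourier f y = (\<integral>s. f s * exp (\<i> * of_real (s * y)) \<partial>lborel)"

lemma fourier_measurable [measurable]:
  assumes [measurable]: "f \<in> borel_measurable borel"
  shows "fourier f \<in> borel_measurable borel"
  unfolding fourier_def by measurable

lemma integrable_mult_iexp:
  assumes "integrable lborel f"
  shows "integrable lborel (\<lambda>s. f s * exp (\<i> * complex_of_real (s * y)))"
proof (rule Bochner_Integration.integrable_bound)
  show "integrable lborel (\<lambda>s. norm (f s))" using assms by simp
  have [measurable]: "f \<in> borel_measurable borel" using assms by auto
  show "(\<lambda>s. f s * exp (\<i> * complex_of_real (s * y))) \<in> borel_measurable lborel" by measurable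
qed (simp add: norm_mult)

lemma norm_fourier_le: "norm (fourier f y) \<le> (\<integral>s. norm (f s) \<partial>lborel)"
proof -
  have "norm (fourier f y) \<le> (\<integral>s. norm (f s * exp (\<i> * of_real (s * y))) \<partial>lborel)"
    unfolding fourier_def by (rule integral_norm_bound)
  then show ?thesis by (simp add: norm_mult)
qed

text \<open>The kernel e^(isy) is symmetric in s and y and has modulus 1, so Fubini applies to f(s)
  g(y) e^(isy).\<close>

lemma fourier_multiplication_formula:
  assumes f: "integrable lborel f" and g: "integrable lborel g"
  shows "(\<integral>y. fourier f y * g y \<partial>lborel) = (\<integral>s. f s * fourier g s \<partial>lborel)"
proof -
  have [measurable]: "f \<in> borel_measurable borel" "g \<in> borel_measurable borel"
    using f g by auto
  define H where "H = (\<lambda>s y. f s * g y * exp (\<i> * complex_of_real (s * y)))"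
  have int: "integrable (lborel \<Otimes>\<^sub>M lborel) (case_prod H)"
  proof (rule lborel_pair.Fubini_integrable)
    show "case_prod H \<in> borel_measurable (lborel \<Otimes>\<^sub>M lborel)"
      unfolding H_def by measurable
    show "AE s in lborel. integrable lborel (\<lambda>y. case_prod H (s, y))"
      using integrable_mult_right[OF integrable_mult_iexp[OF g]]
      by (auto simp: H_def mult_ac intro!: AE_I2)
    show "integrable lborel (\<lambda>s. \<integral>y. norm (case_prod H (s, y)) \<partial>lborel)"
      using f by (simp add: H_def norm_mult)
  qed
  have "(\<integral>y. fourier f y * g y \<partial>lborel) = (\<integral>y. (\<integral>s. H s y \<partial>lborel) \<partial>lborel)"
    by (simp add: fourier_def H_def mult_ac flip: integral_mult_right_zero)
  also have "\<dots> = (\<integral>s. (\<integral>y. H s y \<partial>lborel) \<partial>lborel)"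
    by (rule lborel_pair.Fubini_integral[OF int])
  also have "\<dots> = (\<integral>s. f s * fourier g s \<partial>lborel)"
    by (simp add: fourier_def H_def mult_ac flip: integral_mult_right_zero)
  finally show ?thesis .
qed

text \<open>Makes |fourier G|^2 the product of the transforms of G and of its conjugate reflection,
  a form to which \<open>fourier_multiplication_formula\<close> applies.\<close>

lemma fourier_cnj_reflect: "fourier (\<lambda>s. cnj (f (- s))) y = cnj (fourier f y)"
proof -
  have "fourier (\<lambda>s. cnj (f (- s))) y = (\<integral>s. cnj (f (- s) * exp (\<i> * of_real (- s * y))) \<partial>lborel)"
    by (simp add: fourier_def exp_cnj)
  also have "\<dots> = cnj (\<integral>s. f (- s) * exp (\<i> * of_real (- s * y)) \<partial>lborel)"
    by (rule Bochner_Integration.integral_cnj)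
  also have "(\<integral>s. f (- s) * exp (\<i> * of_real (- s * y)) \<partial>lborel) = fourier f y"
    unfolding fourier_def
    by (subst (2) lborel_integral_real_affine[of "-1" _ 0]) simp_all
  finally show ?thesis .
qed

lemma fourier_std_normal:
  "fourier (\<lambda>x. complex_of_real (std_normal_density x)) t = of_real (exp (- t\<^sup>2 / 2))"
proof -
  have "char std_normal_distribution t = (\<integral>x. std_normal_density x *\<^sub>R exp (\<i> * of_real (t * x)) \<partial>lborel)"
    unfolding char_def by (subst integral_density) (auto simp: normal_density_nonneg)
  then show ?thesis
    by (simp add: char_std_normal_distribution fourier_def scaleR_conv_of_real mult_ac)
qed

lemma exp_square_eq_std_normal: "exp (- x\<^sup>2 / 2) = sqrt (2 * pi) * std_normal_density x"
  by (simp add: std_normal_density_def)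

lemma integrable_gaussian: "(c::real) \<noteq> 0 \<Longrightarrow> integrable lborel (\<lambda>y. exp (- (c * y)\<^sup>2 / 2))"
  unfolding exp_square_eq_std_normal
  using lborel_integrable_real_affine[of "std_normal_density" c 0] by simp

text \<open>Stated with a density because, as a function of v, the transform is 2 pi times a
  probability density of width c: an approximate identity as c tends to 0.\<close>

lemma fourier_gaussian:
  assumes c: "c > 0"
  shows "fourier (\<lambda>y. complex_of_real (exp (- (c * y)\<^sup>2 / 2))) v =
     of_real (2 * pi / c * std_normal_density (v / c))"
proof -
  have "of_real (sqrt (2 * pi) * exp (- (v / c)\<^sup>2 / 2)) = of_real (sqrt (2 * pi)) *
     fourier (\<lambda>x. complex_of_real (std_normal_density x)) (v / c)"
    by (simp add: fourier_std_normal)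
  also have "\<dots> = (\<integral>x. of_real (exp (- x\<^sup>2 / 2)) * exp (\<i> * of_real (x * (v / c))) \<partial>lborel)"
    unfolding exp_square_eq_std_normal fourier_def
    by (simp add: mult.assoc flip: integral_mult_right_zero)
  also have "\<dots> = c *\<^sub>R (\<integral>y. of_real (exp (- (c * y)\<^sup>2 / 2)) * exp (\<i> * of_real (y * v)) \<partial>lborel)"
    by (subst lborel_integral_real_affine[of c _ 0]) (use c in auto)
  also have "\<dots> = of_real c * fourier (\<lambda>y. complex_of_real (exp (- (c * y)\<^sup>2 / 2))) v"
    by (simp add: fourier_def scaleR_conv_of_real)
  finally have *: "of_real (sqrt (2 * pi) * exp (- (v / c)\<^sup>2 / 2)) = \<dots>" .
  have "sqrt (2 * pi) * exp (- (v / c)\<^sup>2 / 2) = 2 * pi * std_normal_density (v / c)"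
    by (simp add: std_normal_density_def field_simps)
  with * have **: "of_real c * fourier (\<lambda>y. complex_of_real (exp (- (c * y)\<^sup>2 / 2))) v =
      of_real (2 * pi * std_normal_density (v / c))"
    by (simp only:)
  have "fourier (\<lambda>y. complex_of_real (exp (- (c * y)\<^sup>2 / 2))) v =
      of_real c * fourier (\<lambda>y. complex_of_real (exp (- (c * y)\<^sup>2 / 2))) v / of_real c"
    using c by simp
  also have "\<dots> = of_real (2 * pi / c * std_normal_density (v / c))"
    unfolding ** by simp
  finally show ?thesis .
qed

text \<open>The Gaussian factor secures integrability, so the multiplication formula can be used
  twice: once to turn the transform of \<open>fourier R * g\<close> into an average of the conjugate
  of G at scale c around s, and once to move the transform off G.\<close>

lemma fourier_gaussian_regularised:
  assumes G: "integrable lborel G" and c: "c > 0"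
  shows "(\<integral>y. (cmod (fourier G y))\<^sup>2 * exp (- (c * y)\<^sup>2 / 2) \<partial>lborel) =
     2 * pi * Re (\<integral>s. G s * (\<integral>x. cnj (G (s - c * x)) * of_real (std_normal_density x) \<partial>lborel) \<partial>lborel)"
proof -
  have [measurable]: "G \<in> borel_measurable borel" using G by auto
  define R where "R = (\<lambda>s. cnj (G (- s)))"
  have R: "integrable lborel R"
    unfolding R_def using lborel_integrable_real_affine[OF G, of "-1" 0] by simp
  define g where "g = (\<lambda>y. complex_of_real (exp (- (c * y)\<^sup>2 / 2)))"
  have [measurable]: "R \<in> borel_measurable borel" "g \<in> borel_measurable borel"
    by (auto simp: R_def g_def)
  have g: "integrable lborel g"
    using integrable_gaussian[of c] c by (auto simp: g_def)
  have Rg: "integrable lborel (\<lambda>y. fourier R y * g y)"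
  proof (rule Bochner_Integration.integrable_bound)
    show "integrable lborel (\<lambda>y. (\<integral>s. norm (R s) \<partial>lborel) * norm (g y))"
      using g by (intro integrable_mult_right integrable_norm)
  qed (auto simp: norm_mult intro!: mult_right_mono norm_fourier_le AE_I2 order_trans[OF _ abs_ge_self])
  have inner: "fourier (\<lambda>y. fourier R y * g y) s =
      2 * pi * (\<integral>x. cnj (G (s - c * x)) * of_real (std_normal_density x) \<partial>lborel)" for s
  proof -
    \<comment> \<open>Modulating a function by e^(iys) shifts the argument of its transform by
      s.\<close>
    have shift: "fourier (\<lambda>y. g y * exp (\<i> * of_real (y * s))) t =
        of_real (2 * pi / c * std_normal_density ((s + t) / c))" for t
      using fourier_gaussian[OF c, of "s + t"]
      by (simp add: g_def fourier_def algebra_simps exp_add)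
    have "fourier (\<lambda>y. fourier R y * g y) s =
       (\<integral>y. fourier R y * (g y * exp (\<i> * of_real (y * s))) \<partial>lborel)"
      by (simp add: fourier_def mult.assoc)
    also have "\<dots> = (\<integral>t. R t * fourier (\<lambda>y. g y * exp (\<i> * of_real (y * s))) t \<partial>lborel)"
      by (intro fourier_multiplication_formula R integrable_mult_iexp g)
    also have "\<dots> = (\<integral>t. R t * of_real (2 * pi / c * std_normal_density ((s + t) / c)) \<partial>lborel)"
      by (simp only: shift)
    \<comment> \<open>Substituting t = -s + c x centres the Gaussian at 0 and turns R(t) into the
      conjugate of G(s - c x).\<close>
    also have "\<dots> =
       c *\<^sub>R (\<integral>x. R (- s + c * x) * of_real (2 * pi / c * std_normal_density ((s + (- s + c * x)) / c)) \<partial>lborel)"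
      using c by (subst lborel_integral_real_affine[of c _ "- s"]) auto
    also have "\<dots> = c *\<^sub>R (\<integral>x. of_real (2 * pi / c) *
         (cnj (G (s - c * x)) * of_real (std_normal_density x)) \<partial>lborel)"
      using c by (intro arg_cong[where f = "scaleR c"] Bochner_Integration.integral_cong) (auto simp: R_def)
    also have "\<dots> = 2 * pi * (\<integral>x. cnj (G (s - c * x)) * of_real (std_normal_density x) \<partial>lborel)"
      using c unfolding integral_mult_right_zero by (simp add: scaleR_conv_of_real)
    finally show ?thesis .
  qed
  have "of_real (\<integral>y. (cmod (fourier G y))\<^sup>2 * exp (- (c * y)\<^sup>2 / 2) \<partial>lborel) =
     (\<integral>y. complex_of_real ((cmod (fourier G y))\<^sup>2 * exp (- (c * y)\<^sup>2 / 2)) \<partial>lborel)"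
    by (rule integral_complex_of_real[symmetric])
  also have "\<dots> = (\<integral>y. fourier G y * (fourier R y * g y) \<partial>lborel)"
    unfolding of_real_mult complex_norm_square by (simp add: R_def fourier_cnj_reflect g_def mult.assoc)
  also have "\<dots> = (\<integral>s. G s * fourier (\<lambda>y. fourier R y * g y) s \<partial>lborel)"
    by (rule fourier_multiplication_formula[OF G Rg])
  also have "\<dots> = of_real (2 * pi) * (\<integral>s. G s * (\<integral>x. cnj (G (s - c * x)) * of_real (std_normal_density x) \<partial>lborel) \<partial>lborel)"
    unfolding inner by (simp add: mult_ac flip: integral_mult_right_zero)
  finally have "complex_of_real (\<integral>y. (cmod (fourier G y))\<^sup>2 * exp (- (c * y)\<^sup>2 / 2) \<partial>lborel) = \<dots>" .
  from arg_cong[OF this, of Re] show ?thesis by simp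
qed

text \<open>The width c tends to 0 in the regularised identity. On the right the averages are
  bounded by B and converge pointwise by continuity, so dominated convergence applies. On the left
  the weights increase to 1, and monotone convergence yields integrability along with the
  value.\<close>

theorem plancherel:
  assumes G: "integrable lborel G" and cont: "continuous_on UNIV G"
    and bound: "\<And>s. cmod (G s) \<le> B"
  shows "has_bochner_integral lborel (\<lambda>y. (cmod (fourier G y))\<^sup>2)
     (2 * pi * (\<integral>s. (cmod (G s))\<^sup>2 \<partial>lborel))"
proof -
  have [measurable]: "G \<in> borel_measurable borel" using G by auto
  define c where "c = (\<lambda>n. 1 / real (Suc n))"
  have c: "c n > 0" for n by (simp add: c_def)
  have c0: "c \<longlonglongrightarrow> 0" unfolding c_def by (rule LIMSEQ_Suc[OF lim_1_over_n])
  define I where "I = (\<lambda>n s. \<integral>x. cnj (G (s - c n * x)) * of_real (std_normal_density x) \<partial>lborel)"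
  have std: "integrable lborel (\<lambda>x. B * std_normal_density x)" by auto
  have I_bd: "cmod (I n s) \<le> B" for n s
  proof -
    have "cmod (I n s) \<le> (\<integral>x. B * std_normal_density x \<partial>lborel)"
      unfolding I_def
    proof (rule Bochner_Integration.integral_norm_bound_integral[OF _ std])
      show "integrable lborel (\<lambda>x. cnj (G (s - c n * x)) * of_real (std_normal_density x))"
        by (rule Bochner_Integration.integrable_bound[OF std])
           (auto simp: norm_mult bound intro!: mult_right_mono AE_I2 order_trans[OF _ abs_ge_self])
    qed (auto simp: norm_mult bound intro!: mult_right_mono)
    then show ?thesis by simp
  qed
  have I_lim: "(\<lambda>n. I n s) \<longlonglongrightarrow> cnj (G s)" for s
  proof -
    have "(\<lambda>n. I n s) \<longlonglongrightarrow> (\<integral>x. cnj (G s) * of_real (std_normal_density x) \<partial>lborel)"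
      unfolding I_def
    proof (rule integral_dominated_convergence[OF _ _ std])
      have "(\<lambda>n. G (s - c n * x)) \<longlonglongrightarrow> G s" for x
      proof (rule continuous_on_tendsto_compose[OF cont])
        show "(\<lambda>n. s - c n * x) \<longlonglongrightarrow> s"
          by (rule tendsto_eq_intros c0 refl | simp)+
      qed auto
      then show "AE x in lborel. (\<lambda>n. cnj (G (s - c n * x)) * complex_of_real (std_normal_density x))
          \<longlonglongrightarrow> cnj (G s) * complex_of_real (std_normal_density x)"
        by (intro AE_I2 tendsto_intros)
    qed (auto simp: norm_mult bound intro!: mult_right_mono AE_I2)
    then show ?thesis by simp
  qed
  have [measurable]: "I n \<in> borel_measurable borel" for n
    unfolding I_def by measurable
  have "(\<lambda>n. \<integral>s. G s * I n s \<partial>lborel) \<longlonglongrightarrow> (\<integral>s. G s * cnj (G s) \<partial>lborel)"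
  proof (rule integral_dominated_convergence[where w = "\<lambda>s. cmod (G s) * B"])
    show "integrable lborel (\<lambda>s. cmod (G s) * B)" using G by auto
  qed (auto simp: norm_mult I_bd intro!: mult_left_mono AE_I2 tendsto_intros I_lim)
  also have "(\<integral>s. G s * cnj (G s) \<partial>lborel) = of_real (\<integral>s. (cmod (G s))\<^sup>2 \<partial>lborel)"
    unfolding integral_complex_of_real[symmetric] complex_norm_square ..
  finally have "(\<lambda>n. 2 * pi * Re (\<integral>s. G s * I n s \<partial>lborel)) \<longlonglongrightarrow> 
     2 * pi * Re (of_real (\<integral>s. (cmod (G s))\<^sup>2 \<partial>lborel))"
    by (intro tendsto_intros)
  then have lim: "(\<lambda>n. \<integral>y. (cmod (fourier G y))\<^sup>2 * exp (- (c n * y)\<^sup>2 / 2) \<partial>lborel) \<longlonglongrightarrow>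
     2 * pi * (\<integral>s. (cmod (G s))\<^sup>2 \<partial>lborel)"
    unfolding fourier_gaussian_regularised[OF G c] I_def by simp
  show ?thesis
  proof (rule has_bochner_integral_monotone_convergence[OF _ _ _ lim])
    show "integrable lborel (\<lambda>y. (cmod (fourier G y))\<^sup>2 * exp (- (c n * y)\<^sup>2 / 2))" for n
    proof (rule Bochner_Integration.integrable_bound)
      show "integrable lborel (\<lambda>y. (\<integral>s. norm (G s) \<partial>lborel)\<^sup>2 * exp (- (c n * y)\<^sup>2 / 2))"
        using c[of n] by (intro integrable_mult_right integrable_gaussian) auto
    qed (auto intro!: mult_right_mono power_mono norm_fourier_le AE_I2)
    have "c m \<le> c n" if "n \<le> m" for m n
      using that by (auto simp: c_def frac_le)
    then have "(c m * y)\<^sup>2 \<le> (c n * y)\<^sup>2" if "n \<le> m" for m n y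
      using that c[of m] unfolding power_mult_distrib by (intro mult_right_mono power_mono) auto
    then show "AE y in lborel. mono (\<lambda>n. (cmod (fourier G y))\<^sup>2 * exp (- (c n * y)\<^sup>2 / 2))"
      by (intro AE_I2 monoI mult_left_mono) auto
    have "(\<lambda>n. (cmod (fourier G y))\<^sup>2 * exp (- (c n * y)\<^sup>2 / 2)) \<longlonglongrightarrow>
       (cmod (fourier G y))\<^sup>2 * exp (- (0 * y)\<^sup>2 / 2)" for y
      by (intro tendsto_intros c0) auto
    then show "AE y in lborel. (\<lambda>n. (cmod (fourier G y))\<^sup>2 * exp (- (c n * y)\<^sup>2 / 2)) \<longlonglongrightarrow>
       (cmod (fourier G y))\<^sup>2"
      by simp
  qed auto
qed

section \<open>The Laplace transform of the Meixner measure\<close>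

text \<open>For w = e^(i\<theta>), the bound on \<theta> says Re w > 0. The transform of
  \<open>G\<close> at y is Gamma(p + iy) w^(-(p + iy)), and the power of w has modulus e^(\<theta>
  y). The square |G|^2 is again a Gamma integrand, with exponent 2p and rate 2 cos \<theta>.\<close>

lemma has_bochner_integral_cmod_Gamma_exp:
  fixes p \<theta> :: real
  assumes p: "p > 0" and \<theta>: "\<bar>\<theta>\<bar> < pi / 2"
  shows "has_bochner_integral lborel (\<lambda>y. exp (2 * \<theta> * y) * (cmod (Gamma (of_real p + \<i> * of_real y)))\<^sup>2)
     (2 * pi * Gamma (2 * p) * (2 * cos \<theta>) powr - (2 * p))"
proof -
  define w where "w = cis \<theta>"
  have Ln_w: "Ln w = \<i> * of_real \<theta>"
    unfolding w_def cis_conv_exp using \<theta> by (intro Ln_exp) auto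
  have c: "cos \<theta> > 0" using \<theta> by (intro cos_gt_zero_pi) auto
  define G where "G = (\<lambda>s::real. exp (of_real p * of_real s - w * of_real (exp s)))"
  have normG: "cmod (G s) = exp (p * s - cos \<theta> * exp s)" for s
    by (simp add: G_def w_def)
  have "has_bochner_integral lborel G (Gamma (of_real p) * w powr - of_real p)"
    unfolding G_def
    by (intro has_bochner_integral_Gamma_exp_complex) (use p c in \<open>auto simp: w_def\<close>)
  then have G: "integrable lborel G" by (auto simp: has_bochner_integral_iff)
  have "continuous_on UNIV G" unfolding G_def by (intro continuous_intros)
  \<comment> \<open>The exponent p s - cos \<theta> e^s is maximal at s = ln (p / cos \<theta>);
    this follows from e^x >= 1 + x with x the distance of s from that point.\<close>
  moreover have "cmod (G s) \<le> exp (p * ln (p / cos \<theta>) - p)" for s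
  proof -
    have "cos \<theta> * exp s = p * exp (s - ln (p / cos \<theta>))"
      using p c by (simp add: exp_diff)
    also have "\<dots> \<ge> p * (1 + (s - ln (p / cos \<theta>)))"
      using p by (intro mult_left_mono exp_ge_add_one_self) auto
    finally show ?thesis by (simp add: normG algebra_simps)
  qed
  ultimately have pl: "has_bochner_integral lborel (\<lambda>y. (cmod (fourier G y))\<^sup>2)
     (2 * pi * (\<integral>s. (cmod (G s))\<^sup>2 \<partial>lborel))"
    by (rule plancherel[OF G])
  have norm_fourier: "(cmod (fourier G y))\<^sup>2 = exp (2 * \<theta> * y) * (cmod (Gamma (of_real p + \<i> * of_real y)))\<^sup>2" for y
  proof -
    let ?z = "of_real p + \<i> * of_real y"
    have "has_bochner_integral lborel (\<lambda>s. exp (?z * of_real s - w * of_real (exp s))) (Gamma ?z * w powr - ?z)"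
      by (intro has_bochner_integral_Gamma_exp_complex) (use p c in \<open>auto simp: w_def\<close>)
    then have "fourier G y = Gamma ?z * w powr - ?z"
      by (simp add: fourier_def G_def has_bochner_integral_iff algebra_simps flip: exp_add)
    moreover have "cmod (w powr - ?z) = exp (\<theta> * y)"
      by (simp add: powr_def Ln_w) (simp add: w_def algebra_simps)
    moreover have "exp (\<theta> * y) ^ 2 = exp (2 * \<theta> * y)"
      by (simp add: power2_eq_square flip: exp_add)
    ultimately show ?thesis by (simp add: norm_mult power_mult_distrib)
  qed
  have norm_G: "(\<integral>s. (cmod (G s))\<^sup>2 \<partial>lborel) = Gamma (2 * p) * (2 * cos \<theta>) powr - (2 * p)"
  proof -
    have *: "has_bochner_integral lborel
        (\<lambda>s. exp (of_real (2 * p) * of_real s - of_real (2 * cos \<theta> * exp s)))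
        (Gamma (complex_of_real (2 * p)) * of_real (2 * cos \<theta>) powr - of_real (2 * p))"
      by (intro has_bochner_integral_Gamma_exp_of_real) (use p c in auto)
    have "exp (of_real (2 * p) * of_real s - of_real (2 * cos \<theta> * exp s)) =
        complex_of_real ((cmod (G s))\<^sup>2)" for s
      by (simp add: normG power2_eq_square algebra_simps flip: exp_of_real exp_add)
    moreover have "Gamma (complex_of_real (2 * p)) * of_real (2 * cos \<theta>) powr - of_real (2 * p) =
       of_real (Gamma (2 * p) * (2 * cos \<theta>) powr - (2 * p))"
      using c powr_of_real[of "2 * cos \<theta>" "- (2 * p)"] Gamma_complex_of_real[of "2 * p"]
      by (simp only: of_real_mult of_real_minus less_imp_le)
    ultimately have "has_bochner_integral lborel (\<lambda>s. complex_of_real ((cmod (G s))\<^sup>2))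
       (of_real (Gamma (2 * p) * (2 * cos \<theta>) powr - (2 * p)))"
      using * by (simp only:)
    then show ?thesis
      by (simp only: has_bochner_integral_iff integral_complex_of_real of_real_eq_iff)
  qed
  show ?thesis using pl unfolding norm_fourier norm_G by (simp only: mult.assoc)
qed

locale meixner =
  fixes \<alpha> :: complex and \<sigma> :: real
  assumes Im_pos: "Im \<alpha> > 0" and \<sigma>_pos: "\<sigma> > 0"
begin

abbreviation "\<beta> \<equiv> cnj \<alpha>"
definition "\<eta> = Re (\<alpha> * \<beta>)"
definition "\<phi> = pi / 2 - Arg \<alpha>"
text \<open>The shape parameter: twice the real part of the Gamma argument in the density. Replacing
  \<sigma> by \<eta> n + \<sigma> replaces \<kappa> by \<kappa> + n.\<close>

definition "\<kappa> = \<sigma> / \<eta>"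

lemma \<alpha>_neq_0: "\<alpha> \<noteq> 0" using Im_pos by auto

lemma \<eta>_cmod: "\<eta> = (cmod \<alpha>)\<^sup>2"
  unfolding cmod_power2 by (simp add: \<eta>_def power2_eq_square)

lemma \<eta>_pos: "\<eta> > 0" using \<alpha>_neq_0 by (simp add: \<eta>_cmod)

lemma of_real_\<eta>: "of_real \<eta> = \<alpha> * \<beta>"
  unfolding \<eta>_cmod complex_norm_square ..

lemma \<kappa>_pos: "\<kappa> > 0" using \<sigma>_pos \<eta>_pos by (simp add: \<kappa>_def)

lemma \<phi>_bounds: "\<bar>\<phi>\<bar> < pi / 2"
proof -
  have "0 < Arg \<alpha>" "Arg \<alpha> < pi" using Im_pos Arg_lt_pi[of \<alpha>] by auto
  then show ?thesis unfolding \<phi>_def by linarith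
qed

lemma cos_\<phi>_pos: "cos \<phi> > 0"
  using \<phi>_bounds by (intro cos_gt_zero_pi) auto

lemma \<alpha>_polar: "\<alpha> = of_real (cmod \<alpha>) * (\<i> * cis (- \<phi>))"
proof -
  have "\<i> * cis (- \<phi>) = cis (Arg \<alpha>)"
    by (simp add: \<phi>_def complex_eq_iff cos_diff sin_diff)
  moreover have "\<alpha> = of_real (cmod \<alpha>) * cis (Arg \<alpha>)"
    using \<alpha>_neq_0 by (simp add: rcis_cmod_Arg flip: rcis_def)
  ultimately show ?thesis by simp
qed

text \<open>The Laplace transform of the Meixner measure is the \<kappa>-th power of this function,
  which does not itself involve \<sigma>.\<close>

definition laplace :: "real \<Rightarrow> real" where
  "laplace u = exp (- u * Re \<alpha>) * cos \<phi> / cos (\<phi> + Im \<alpha> * u)"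

end

text \<open>Because \<beta> = Re \<alpha> - i Im \<alpha>, the Gamma argument has constant real part
  \<kappa>/2. With y = (x + \<kappa> Re \<alpha>) / (2 Im \<alpha>) the density becomes a multiple
  of e^(2 \<phi> y) |Gamma(\<kappa>/2 + iy)|^2.\<close>

lemma (in meixner) meixner_density_eq:
  "meixner_density \<alpha> \<beta> \<sigma> x =
    (2 * cos \<phi>) powr \<kappa> / (4 * Im \<alpha> * pi * Gamma \<kappa>) * exp (\<phi> * (x + \<kappa> * Re \<alpha>) / Im \<alpha>) *
    (cmod (Gamma (of_real (\<kappa> / 2) + \<i> * of_real ((x + \<kappa> * Re \<alpha>) / (2 * Im \<alpha>)))))\<^sup>2"
proof -
  have "\<i> * of_real x / of_real (2 * Im \<alpha>) + \<i> * of_real \<sigma> * \<beta> / of_real (2 * \<eta> * Im \<alpha>) =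
     of_real (\<kappa> / 2) + \<i> * of_real ((x + \<kappa> * Re \<alpha>) / (2 * Im \<alpha>))"
    using Im_pos \<eta>_pos by (simp add: complex_eq_iff \<kappa>_def field_simps)
  moreover have "exp (\<phi> * \<sigma> * Re \<alpha> / (Im \<alpha> * \<eta>)) * exp (\<phi> * x / Im \<alpha>) = exp (\<phi> * (x + \<kappa> * Re \<alpha>) / Im \<alpha>)"
    using Im_pos \<eta>_pos by (simp add: \<kappa>_def field_simps flip: exp_add)
  ultimately show ?thesis
    unfolding meixner_density_def meixner_const_def Let_def \<eta>_def[symmetric] \<phi>_def[symmetric]
      \<kappa>_def[symmetric]
    by simp
qed

lemma (in meixner) meixner_density_measurable [measurable]:
  "meixner_density \<alpha> \<beta> \<sigma> \<in> borel_measurable borel"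
proof -
  have z: "of_real (\<kappa> / 2) + \<i> * of_real t \<notin> \<int>\<^sub>\<le>\<^sub>0" for t
  proof
    assume "of_real (\<kappa> / 2) + \<i> * of_real t \<in> (\<int>\<^sub>\<le>\<^sub>0 :: complex set)"
    then have "Re (of_real (\<kappa> / 2) + \<i> * of_real t) \<le> 0"
      by (elim nonpos_Ints_cases) simp
    then show False using \<kappa>_pos by simp
  qed
  have "continuous_on UNIV (\<lambda>x. Gamma (of_real (\<kappa> / 2) + \<i> * complex_of_real ((x + \<kappa> * Re \<alpha>) / (2 * Im \<alpha>))))"
    using Im_pos z by (intro continuous_on_compose2[OF continuous_on_Gamma[of "- \<int>\<^sub>\<le>\<^sub>0"]]
      continuous_on_add continuous_on_mult continuous_on_of_real continuous_on_divide continuous_on_const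
      continuous_on_id) (auto simp del: of_real_divide of_real_add)
  then have "continuous_on UNIV (meixner_density \<alpha> \<beta> \<sigma>)"
    unfolding meixner_density_eq
    by (intro continuous_on_mult continuous_on_power continuous_on_norm continuous_on_const
      continuous_on_exp continuous_on_add continuous_on_divide continuous_on_id) (use Im_pos in auto)
  then show ?thesis by (rule borel_measurable_continuous_onI)
qed

lemma (in meixner) meixner_density_nonneg: "meixner_density \<alpha> \<beta> \<sigma> x \<ge> 0"
  unfolding meixner_density_eq using \<kappa>_pos Im_pos cos_\<phi>_pos Gamma_real_pos[of \<kappa>] by simp

text \<open>In the variable y of \<open>meixner_density_eq\<close>, the weight e^(ux) merely moves
  the angle from \<phi> to \<phi> + u Im \<alpha>, so
  \<open>has_bochner_integral_cmod_Gamma_exp\<close> applies. For u = 0 the value is 1, the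
  normalisation of the measure.\<close>

lemma (in meixner) has_bochner_integral_meixner_exp:
  assumes u: "\<bar>\<phi> + Im \<alpha> * u\<bar> < pi / 2"
  shows "has_bochner_integral (meixner_measure \<alpha> \<beta> \<sigma>) (\<lambda>x. exp (u * x)) (laplace u powr \<kappa>)"
proof -
  define c where "c = 2 * Im \<alpha>"
  have c: "c > 0" using Im_pos by (simp add: c_def)
  define t where "t = - \<kappa> * Re \<alpha>"
  define C where "C = (2 * cos \<phi>) powr \<kappa> / (4 * Im \<alpha> * pi * Gamma \<kappa>) * exp (u * t)"
  have cos: "cos (\<phi> + Im \<alpha> * u) > 0" by (rule cos_gt_zero_pi) (use u in linarith)+
  have eq: "meixner_density \<alpha> \<beta> \<sigma> (t + c * y) * exp (u * (t + c * y)) =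
     C * (exp (2 * (\<phi> + Im \<alpha> * u) * y) * (cmod (Gamma (of_real (\<kappa> / 2) + \<i> * of_real y)))\<^sup>2)" for y
  proof -
    have "(t + c * y + \<kappa> * Re \<alpha>) / (2 * Im \<alpha>) = y" "\<phi> * (t + c * y + \<kappa> * Re \<alpha>) / Im \<alpha> = 2 * \<phi> * y"
      using Im_pos by (auto simp: t_def c_def)
    moreover have "exp (2 * \<phi> * y) * exp (u * (t + c * y)) = exp (u * t) * exp (2 * (\<phi> + Im \<alpha> * u) * y)"
      by (simp add: c_def algebra_simps flip: exp_add)
    ultimately show ?thesis by (simp add: meixner_density_eq C_def)
  qed
  have "has_bochner_integral lborel
     (\<lambda>y. exp (2 * (\<phi> + Im \<alpha> * u) * y) * (cmod (Gamma (of_real (\<kappa> / 2) + \<i> * of_real y)))\<^sup>2)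
     (2 * pi * Gamma (2 * (\<kappa> / 2)) * (2 * cos (\<phi> + Im \<alpha> * u)) powr - (2 * (\<kappa> / 2)))"
    using \<kappa>_pos u by (intro has_bochner_integral_cmod_Gamma_exp) auto
  from has_bochner_integral_mult_right[OF this, of C]
  have "has_bochner_integral lborel (\<lambda>y. meixner_density \<alpha> \<beta> \<sigma> (t + c * y) * exp (u * (t + c * y)))
     (C * (2 * pi * Gamma \<kappa> * (2 * cos (\<phi> + Im \<alpha> * u)) powr - \<kappa>))"
    unfolding eq by simp
  also have "C * (2 * pi * Gamma \<kappa> * (2 * cos (\<phi> + Im \<alpha> * u)) powr - \<kappa>) = (laplace u powr \<kappa>) /\<^sub>R \<bar>c\<bar>"
  proof -
    have "laplace u powr \<kappa> = (2 * cos \<phi>) powr \<kappa> * exp (u * t) * (2 * cos (\<phi> + Im \<alpha> * u)) powr - \<kappa>"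
      using cos cos_\<phi>_pos
      by (simp add: laplace_def powr_divide powr_mult powr_minus t_def field_simps exp_powr_real)
    then show ?thesis
      using Im_pos Gamma_real_pos[OF \<kappa>_pos] by (simp add: C_def c_def field_simps)
  qed
  finally have "has_bochner_integral lborel (\<lambda>x. meixner_density \<alpha> \<beta> \<sigma> x * exp (u * x)) (laplace u powr \<kappa>)"
    by (subst lborel_has_bochner_integral_real_affine_iff[of c _ _ t]) (use c in auto)
  then show ?thesis
    unfolding meixner_measure_def
    by (intro has_bochner_integral_density) (auto intro!: AE_I2 meixner_density_nonneg)
qed

section \<open>The integral operator on functions of exponential growth\<close>

lemma power_le_fact_mult_exp:
  fixes x :: real
  assumes "x \<ge> 0"
  shows "x ^ k \<le> fact k * exp x"
proof -
  have "x ^ k /\<^sub>R fact k \<le> (\<Sum>n<Suc k. x ^ n /\<^sub>R fact n)"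
    using assms by (simp add: sum_nonneg)
  also have "\<dots> \<le> exp x" using assms by (rule sum_exp_series_le)
  finally show ?thesis by (simp add: field_simps)
qed

section \<open>Exponential moments of the fibre measures\<close>

context meixner
begin

abbreviation "\<mu> n \<equiv> meixner_measure \<alpha> \<beta> (\<eta> * real n + \<sigma>)"

lemma sets_\<mu> [measurable_cong, simp]: "sets (\<mu> n) = sets borel"
  by (simp add: meixner_measure_def)

lemma space_\<mu> [simp]: "space (\<mu> n) = UNIV"
  by (simp add: meixner_measure_def)

text \<open>An exponential rate admissible for all fibre measures at once: for |u| at most
  \<epsilon>, the angle \<phi> + u Im \<alpha> uses up at most half of the distance from |\<phi>| to
  pi/2.\<close>

definition "\<epsilon> = (pi / 2 - \<bar>\<phi>\<bar>) / (2 * Im \<alpha>)"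

lemma \<epsilon>_pos: "\<epsilon> > 0"
  using \<phi>_bounds Im_pos by (simp add: \<epsilon>_def)

lemma strip_bound:
  assumes "\<bar>u\<bar> \<le> \<epsilon>"
  shows "\<bar>\<phi> + Im \<alpha> * u\<bar> < pi / 2"
proof -
  have "Im \<alpha> * \<bar>u\<bar> \<le> Im \<alpha> * \<epsilon>" using assms Im_pos by (intro mult_left_mono) auto
  also have "\<dots> = (pi / 2 - \<bar>\<phi>\<bar>) / 2" using Im_pos by (simp add: \<epsilon>_def)
  finally have "\<bar>Im \<alpha> * u\<bar> \<le> (pi / 2 - \<bar>\<phi>\<bar>) / 2" using Im_pos by (simp add: abs_mult)
  then show ?thesis using \<phi>_bounds abs_triangle_ineq[of \<phi> "Im \<alpha> * u"] by (simp add: field_simps)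
qed

lemma laplace_pos:
  assumes "\<bar>u\<bar> \<le> \<epsilon>"
  shows "laplace u > 0"
proof -
  have "cos (\<phi> + Im \<alpha> * u) > 0" by (rule cos_gt_zero_pi) (use strip_bound[OF assms] in linarith)+
  then show ?thesis using cos_\<phi>_pos by (simp add: laplace_def)
qed

text \<open>Passing to the n-th fibre turns \<kappa> into \<kappa> + n. The dependence on n is thus
  geometric, which is what makes the Poisson sums computable.\<close>

lemma has_bochner_integral_\<mu>_exp:
  assumes "\<bar>u\<bar> \<le> \<epsilon>"
  shows "has_bochner_integral (\<mu> n) (\<lambda>x. exp (u * x)) (laplace u powr \<kappa> * laplace u ^ n)"
proof -
  interpret n: meixner \<alpha> "\<eta> * real n + \<sigma>"
    using Im_pos \<sigma>_pos \<eta>_pos by unfold_locales (auto intro!: add_nonneg_pos)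
  have "n.\<kappa> = \<kappa> + real n"
    using \<eta>_pos by (simp add: n.\<kappa>_def \<kappa>_def add_divide_distrib)
  then show ?thesis
    using n.has_bochner_integral_meixner_exp[OF strip_bound[OF assms]] laplace_pos[OF assms]
    by (simp add: powr_add powr_realpow)
qed

definition "laplace_sum = laplace \<epsilon> + laplace (- \<epsilon>)"

text \<open>The majorant e^(\<epsilon> x) + e^(-\<epsilon> x) reduces the claim to two Laplace
  transforms; \<open>laplace_sum\<close> dominates both bases, so one geometric rate in n
  remains.\<close>

lemma integral_\<mu>_exp_abs:
  shows "integrable (\<mu> n) (\<lambda>x. exp (\<epsilon> * \<bar>x\<bar>))"
    and "(\<integral>x. exp (\<epsilon> * \<bar>x\<bar>) \<partial>\<mu> n) \<le> 2 * laplace_sum powr \<kappa> * laplace_sum ^ n"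
proof -
  let ?g = "\<lambda>x. exp (\<epsilon> * x) + exp (- \<epsilon> * x)"
  have pos: "laplace \<epsilon> > 0" "laplace (- \<epsilon>) > 0"
    using \<epsilon>_pos by (intro laplace_pos; simp)+
  have g: "has_bochner_integral (\<mu> n) ?g
     (laplace \<epsilon> powr \<kappa> * laplace \<epsilon> ^ n + laplace (- \<epsilon>) powr \<kappa> * laplace (- \<epsilon>) ^ n)"
    using \<epsilon>_pos by (intro has_bochner_integral_add has_bochner_integral_\<mu>_exp) auto
  have le: "exp (\<epsilon> * \<bar>x\<bar>) \<le> ?g x" for x
    by (cases "x \<ge> 0") auto
  show int: "integrable (\<mu> n) (\<lambda>x. exp (\<epsilon> * \<bar>x\<bar>))"
    by (rule Bochner_Integration.integrable_bound[OF integrable.intros[OF g]])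
       (use le in \<open>auto intro!: AE_I2 order_trans[OF le abs_ge_self]\<close>)
  have "(\<integral>x. exp (\<epsilon> * \<bar>x\<bar>) \<partial>\<mu> n) \<le> (\<integral>x. ?g x \<partial>\<mu> n)"
    using int le integrable.intros[OF g] by (intro integral_mono) auto
  also have "\<dots> = laplace \<epsilon> powr \<kappa> * laplace \<epsilon> ^ n + laplace (- \<epsilon>) powr \<kappa> * laplace (- \<epsilon>) ^ n"
    using g by (rule has_bochner_integral_integral_eq)
  also have "\<dots> \<le> laplace_sum powr \<kappa> * laplace_sum ^ n + laplace_sum powr \<kappa> * laplace_sum ^ n"
    using pos \<kappa>_pos by (intro add_mono mult_mono powr_mono2 power_mono) (auto simp: laplace_sum_def)
  finally show "(\<integral>x. exp (\<epsilon> * \<bar>x\<bar>) \<partial>\<mu> n) \<le> 2 * laplace_sum powr \<kappa> * laplace_sum ^ n" by (simp add: mult_ac)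
qed

section \<open>The iterated integral and its limit theorems\<close>

definition fibre_integral :: "nat \<Rightarrow> (complex \<Rightarrow> complex) \<Rightarrow> complex" where
  "fibre_integral n f = (\<integral>x. f (of_real x + \<beta> * of_nat n) \<partial>\<mu> n)"

text \<open>The integral formula itself is taken as the definition of the extended operator;
  \<open>bargmann_poly\<close> shows that it extends the given one.\<close>

definition bargmann :: "(complex \<Rightarrow> complex) \<Rightarrow> complex \<Rightarrow> complex" where
  "bargmann f z = cpoisson_integral (z / \<beta>) (\<lambda>n. fibre_integral n f)"

text \<open>A class on which the iterated integral converges absolutely. The constant is explicit
  because dominated convergence needs one \<open>B\<close> for a whole sequence of
  functions.\<close>

definition exp_bounded :: "real \<Rightarrow> (complex \<Rightarrow> complex) \<Rightarrow> bool" where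
  "exp_bounded B f \<longleftrightarrow> f \<in> borel_measurable borel \<and> (\<forall>w. cmod (f w) \<le> B * exp (\<epsilon> * cmod w))"

lemma exp_boundedD: "exp_bounded B f \<Longrightarrow> cmod (f w) \<le> B * exp (\<epsilon> * cmod w)"
  by (simp add: exp_bounded_def)

lemma exp_bounded_measurable: "exp_bounded B f \<Longrightarrow> f \<in> borel_measurable borel"
  by (simp add: exp_bounded_def)

lemma exp_bounded_nonneg: "exp_bounded B f \<Longrightarrow> B \<ge> 0"
  using exp_boundedD[of B f 0] order_trans[OF norm_ge_zero] by fastforce

lemma exp_bounded_shift:
  assumes "exp_bounded B f"
  shows "cmod (f (of_real x + \<beta> * of_nat n)) \<le> B * exp (\<epsilon> * cmod \<alpha>) ^ n * exp (\<epsilon> * \<bar>x\<bar>)"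
proof -
  have "cmod (of_real x + \<beta> * of_nat n) \<le> \<bar>x\<bar> + cmod \<alpha> * real n"
    by (rule order_trans[OF norm_triangle_ineq]) (simp add: norm_mult)
  then have "exp (\<epsilon> * cmod (of_real x + \<beta> * of_nat n)) \<le> exp (\<epsilon> * (\<bar>x\<bar> + cmod \<alpha> * real n))"
    using \<epsilon>_pos by simp
  also have "\<dots> = exp (\<epsilon> * cmod \<alpha>) ^ n * exp (\<epsilon> * \<bar>x\<bar>)"
    by (simp add: algebra_simps exp_add flip: exp_of_nat_mult)
  finally show ?thesis
    using exp_boundedD[OF assms, of "of_real x + \<beta> * of_nat n"] exp_bounded_nonneg[OF assms]
    by (smt (verit) mult_left_mono mult.assoc)
qed

lemma exp_bounded_integrable:
  assumes "exp_bounded B f"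
  shows "integrable (\<mu> n) (\<lambda>x. f (of_real x + \<beta> * of_nat n))"
proof (rule Bochner_Integration.integrable_bound)
  show "integrable (\<mu> n) (\<lambda>x. B * exp (\<epsilon> * cmod \<alpha>) ^ n * exp (\<epsilon> * \<bar>x\<bar>))"
    by (intro integrable_mult_right integral_\<mu>_exp_abs)
  have [measurable]: "f \<in> borel_measurable borel" by (rule exp_bounded_measurable[OF assms])
  show "(\<lambda>x. f (of_real x + \<beta> * of_nat n)) \<in> borel_measurable (\<mu> n)" by measurable
qed (auto intro!: AE_I2 order_trans[OF exp_bounded_shift[OF assms] abs_ge_self])

definition "fibre_rate = exp (\<epsilon> * cmod \<alpha>) * laplace_sum"

text \<open>A shift by \<beta> n costs a factor e^(\<epsilon> |\<alpha>| n), and the moments of the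
  fibre grow geometrically. The result is still geometric in n, hence summable against \<zeta>^n /
  n! for every complex \<zeta>.\<close>

lemma norm_fibre_integral_le:
  assumes "exp_bounded B f"
  shows "cmod (fibre_integral n f) \<le> B * (2 * laplace_sum powr \<kappa>) * fibre_rate ^ n"
proof -
  have "cmod (fibre_integral n f) \<le> (\<integral>x. B * exp (\<epsilon> * cmod \<alpha>) ^ n * exp (\<epsilon> * \<bar>x\<bar>) \<partial>\<mu> n)"
    unfolding fibre_integral_def
    by (intro Bochner_Integration.integral_norm_bound_integral exp_bounded_integrable[OF assms]
        integrable_mult_right integral_\<mu>_exp_abs exp_bounded_shift[OF assms])
  also have "\<dots> = B * exp (\<epsilon> * cmod \<alpha>) ^ n * (\<integral>x. exp (\<epsilon> * \<bar>x\<bar>) \<partial>\<mu> n)" by simp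
  also have "\<dots> \<le> B * exp (\<epsilon> * cmod \<alpha>) ^ n * (2 * laplace_sum powr \<kappa> * laplace_sum ^ n)"
    using exp_bounded_nonneg[OF assms] by (intro mult_left_mono integral_\<mu>_exp_abs) auto
  also have "\<dots> = B * (2 * laplace_sum powr \<kappa>) * fibre_rate ^ n" by (simp add: fibre_rate_def power_mult_distrib)
  finally show ?thesis .
qed

definition poisson_bound :: "complex \<Rightarrow> real \<Rightarrow> nat \<Rightarrow> real" where
  "poisson_bound \<zeta> B n = cmod (exp (- \<zeta>)) * (B * (2 * laplace_sum powr \<kappa>)) * ((cmod \<zeta> * fibre_rate) ^ n /\<^sub>R fact n)"

lemma summable_poisson_bound: "summable (poisson_bound \<zeta> B)"
  unfolding poisson_bound_def[abs_def] by (intro summable_mult summable_exp_generic)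

lemma norm_poisson_fibre_integral_le:
  assumes "exp_bounded B f"
  shows "cmod (cpoisson_mass \<zeta> n * fibre_integral n f) \<le> poisson_bound \<zeta> B n"
proof -
  have "cmod (cpoisson_mass \<zeta> n * fibre_integral n f) =
      cmod (exp (- \<zeta>)) * (cmod \<zeta> ^ n / fact n) * cmod (fibre_integral n f)"
    by (simp add: cpoisson_mass_def norm_mult norm_divide norm_power)
  also have "\<dots> \<le> cmod (exp (- \<zeta>)) * (cmod \<zeta> ^ n / fact n) * (B * (2 * laplace_sum powr \<kappa>) * fibre_rate ^ n)"
    by (intro mult_left_mono norm_fibre_integral_le assms) auto
  also have "\<dots> = poisson_bound \<zeta> B n"
    by (simp add: poisson_bound_def power_mult_distrib field_simps)
  finally show ?thesis .
qed

lemma exp_bounded_cpoisson_integrable: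
  assumes "exp_bounded B f"
  shows "cpoisson_integrable \<zeta> (\<lambda>n. fibre_integral n f)"
  unfolding cpoisson_integrable_def integrable_count_space_nat_iff
  by (rule summable_comparison_test'[OF summable_poisson_bound[of \<zeta> B], of 0])
     (simp add: norm_poisson_fibre_integral_le[OF assms])

lemma fibre_integral_add: "exp_bounded A f \<Longrightarrow> exp_bounded B g \<Longrightarrow> fibre_integral n (\<lambda>w. f w + g w) = fibre_integral n f + fibre_integral n g"
  unfolding fibre_integral_def by (intro Bochner_Integration.integral_add exp_bounded_integrable)

lemma bargmann_add:
  assumes "exp_bounded A f" "exp_bounded B g"
  shows "bargmann (\<lambda>w. f w + g w) z = bargmann f z + bargmann g z"
  using exp_bounded_cpoisson_integrable[OF assms(1), of "z / \<beta>"]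
    exp_bounded_cpoisson_integrable[OF assms(2), of "z / \<beta>"]
  unfolding bargmann_def cpoisson_integral_def cpoisson_integrable_def
  by (simp add: fibre_integral_add[OF assms] distrib_left)

lemma bargmann_cmult: "bargmann (\<lambda>w. c * f w) z = c * bargmann f z"
  by (simp add: bargmann_def fibre_integral_def cpoisson_integral_def mult.left_commute)

lemma bargmann_0: "bargmann (\<lambda>w. 0) z = 0"
  using bargmann_cmult[of 0 "\<lambda>w. 0"] by simp

lemma exp_bounded_add:
  "exp_bounded A f \<Longrightarrow> exp_bounded B g \<Longrightarrow> exp_bounded (A + B) (\<lambda>w. f w + g w)"
  unfolding exp_bounded_def distrib_right
  by (auto intro!: order_trans[OF norm_triangle_ineq] add_mono)

lemma exp_bounded_cmult: "exp_bounded A f \<Longrightarrow> exp_bounded (cmod c * A) (\<lambda>w. c * f w)"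
  unfolding exp_bounded_def by (auto simp: norm_mult mult.assoc intro!: mult_left_mono)

lemma exp_bounded_power: "exp_bounded (fact k / \<epsilon> ^ k) (\<lambda>w. w ^ k)"
proof -
  have "cmod w ^ k \<le> fact k / \<epsilon> ^ k * exp (\<epsilon> * cmod w)" for w :: complex
    using power_le_fact_mult_exp[of "\<epsilon> * cmod w" k] \<epsilon>_pos
    by (simp add: power_mult_distrib field_simps)
  then show ?thesis by (simp add: exp_bounded_def norm_power)
qed

lemma exp_bounded_polynomial: "\<exists>B. exp_bounded B (\<lambda>w. \<Sum>k<N. c k * w ^ k)"
proof (induction N)
  case 0
  have "exp_bounded 0 (\<lambda>w. 0)" by (simp add: exp_bounded_def)
  then show ?case by auto
next
  case (Suc N)
  then obtain B where "exp_bounded B (\<lambda>w. \<Sum>k<N. c k * w ^ k)" by blast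
  from exp_bounded_add[OF this exp_bounded_cmult[OF exp_bounded_power, of "c N" N]]
  show ?case by auto
qed

lemma bargmann_polynomial: "bargmann (\<lambda>w. \<Sum>k<N. c k * w ^ k) z = (\<Sum>k<N. c k * bargmann (\<lambda>w. w ^ k) z)"
proof (induction N)
  case (Suc N)
  obtain B where "exp_bounded B (\<lambda>w. \<Sum>k<N. c k * w ^ k)"
    using exp_bounded_polynomial by blast
  from bargmann_add[OF this exp_bounded_cmult[OF exp_bounded_power, of "c N" N]] Suc show ?case
    by (simp add: bargmann_cmult)
qed (simp add: bargmann_0)

lemma fibre_integral_tendsto:
  assumes F: "\<And>k. exp_bounded B (F k)" and f: "f \<in> borel_measurable borel"
    and lim: "\<And>w. (\<lambda>k. F k w) \<longlonglongrightarrow> f w"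
  shows "(\<lambda>k. fibre_integral n (F k)) \<longlonglongrightarrow> fibre_integral n f"
  unfolding fibre_integral_def
proof (rule integral_dominated_convergence)
  note [measurable] = f exp_bounded_measurable[OF F]
  show "integrable (\<mu> n) (\<lambda>x. B * exp (\<epsilon> * cmod \<alpha>) ^ n * exp (\<epsilon> * \<bar>x\<bar>))"
    by (intro integrable_mult_right integral_\<mu>_exp_abs)
  show "(\<lambda>x. f (of_real x + \<beta> * of_nat n)) \<in> borel_measurable (\<mu> n)"
    "\<And>k. (\<lambda>x. F k (of_real x + \<beta> * of_nat n)) \<in> borel_measurable (\<mu> n)" by measurable
qed (auto intro!: AE_I2 lim exp_bounded_shift[OF F])

text \<open>Dominated convergence twice, in the fibres and over the Poisson weights; both majorants
  depend on the sequence only through \<open>B\<close>.\<close>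

lemma bargmann_tendsto:
  assumes F: "\<And>k. exp_bounded B (F k)" and f: "f \<in> borel_measurable borel"
    and lim: "\<And>w. (\<lambda>k. F k w) \<longlonglongrightarrow> f w"
  shows "(\<lambda>k. bargmann (F k) z) \<longlonglongrightarrow> bargmann f z"
  unfolding bargmann_def cpoisson_integral_def
proof (rule integral_dominated_convergence)
  have "poisson_bound (z / \<beta>) B n \<ge> 0" for n
    using norm_poisson_fibre_integral_le[OF F] norm_ge_zero order_trans by blast
  then show "integrable (count_space UNIV) (poisson_bound (z / \<beta>) B)"
    using summable_poisson_bound[of "z / \<beta>" B] by (simp add: integrable_count_space_nat_iff)
qed (auto intro!: AE_I2 tendsto_intros fibre_integral_tendsto[OF F f lim] norm_poisson_fibre_integral_le[OF F])

text \<open>The bound on the absolute partial sums puts all partial sums into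
  \<open>exp_bounded B\<close>. This is applied to the exponential series and to the Taylor series
  of functions in \<open>Emin\<close>.\<close>

lemma bargmann_power_series:
  assumes sums: "\<And>w. (\<lambda>k. c k * w ^ k) sums f w" and f: "f \<in> borel_measurable borel"
    and bound: "\<And>w N. (\<Sum>k<N. cmod (c k * w ^ k)) \<le> B * exp (\<epsilon> * cmod w)"
  shows "(\<lambda>k. c k * bargmann (\<lambda>w. w ^ k) z) sums bargmann f z"
proof -
  have "exp_bounded B (\<lambda>w. \<Sum>k<N. c k * w ^ k)" for N
    unfolding exp_bounded_def using order_trans[OF norm_sum bound] by simp
  from bargmann_tendsto[OF this f sums[unfolded sums_def], of z] show ?thesis
    by (simp add: sums_def bargmann_polynomial)
qed

text \<open>The fibre integrals form a geometric sequence in n with ratio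
  \<open>exp (of_real u * \<beta>) * of_real (laplace u)\<close>, so the Poisson sum is an
  exponential series.\<close>

lemma bargmann_exp:
  assumes u: "\<bar>u\<bar> \<le> \<epsilon>"
  shows "bargmann (\<lambda>w. exp (of_real u * w)) z =
     of_real (laplace u powr \<kappa>) * exp (z / \<beta> * (exp (of_real u * \<beta>) * of_real (laplace u) - 1))"
proof -
  let ?Q = "exp (of_real u * \<beta>) * of_real (laplace u)"
  let ?L = "complex_of_real (laplace u powr \<kappa>)"
  let ?\<zeta> = "z / \<beta>"
  have fibre_integral: "fibre_integral n (\<lambda>w. exp (of_real u * w)) = ?L * ?Q ^ n" for n
  proof -
    have "fibre_integral n (\<lambda>w. exp (of_real u * w)) = (\<integral>x. exp (of_real u * \<beta>) ^ n * complex_of_real (exp (u * x)) \<partial>\<mu> n)"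
      unfolding fibre_integral_def
      by (intro Bochner_Integration.integral_cong)
         (simp_all add: algebra_simps exp_add flip: exp_of_nat_mult exp_of_real)
    also have "\<dots> = exp (of_real u * \<beta>) ^ n * of_real (\<integral>x. exp (u * x) \<partial>\<mu> n)"
      unfolding integral_mult_right_zero integral_complex_of_real ..
    also have "(\<integral>x. exp (u * x) \<partial>\<mu> n) = laplace u powr \<kappa> * laplace u ^ n"
      by (rule has_bochner_integral_integral_eq[OF has_bochner_integral_\<mu>_exp[OF u]])
    finally show ?thesis by (simp add: power_mult_distrib mult_ac)
  qed
  have "exp_bounded 1 (\<lambda>w. exp (of_real u * w))"
  proof -
    have "u * Re w \<le> \<epsilon> * cmod w" for w :: complex
    proof -
      have "u * Re w \<le> \<bar>u\<bar> * \<bar>Re w\<bar>" by (metis abs_ge_self abs_mult)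
      also have "\<dots> \<le> \<epsilon> * cmod w" using u by (intro mult_mono abs_Re_le_cmod) auto
      finally show ?thesis .
    qed
    then show ?thesis by (simp add: exp_bounded_def)
  qed
  from exp_bounded_cpoisson_integrable[OF this, of ?\<zeta>]
  have "bargmann (\<lambda>w. exp (of_real u * w)) z = (\<Sum>n. cpoisson_mass ?\<zeta> n * (?L * ?Q ^ n))"
    unfolding bargmann_def cpoisson_integral_def cpoisson_integrable_def fibre_integral
    by (rule integral_count_space_nat)
  also have "(\<lambda>n. cpoisson_mass ?\<zeta> n * (?L * ?Q ^ n)) =
      (\<lambda>n. exp (- ?\<zeta>) * ?L * ((?\<zeta> * ?Q) ^ n /\<^sub>R fact n))"
    unfolding power_mult_distrib by (simp add: cpoisson_mass_def scaleR_conv_of_real field_simps)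
  also have "(\<Sum>n. exp (- ?\<zeta>) * ?L * ((?\<zeta> * ?Q) ^ n /\<^sub>R fact n)) = exp (- ?\<zeta>) * ?L * exp (?\<zeta> * ?Q)"
    using sums_mult[OF exp_converges[of "?\<zeta> * ?Q"], of "exp (- ?\<zeta>) * ?L"] by (simp only: sums_iff)
  also have "\<dots> = ?L * exp (?\<zeta> * (?Q - 1))"
    unfolding right_diff_distrib exp_diff by (simp add: exp_minus field_simps)
  finally show ?thesis .
qed

end

section \<open>The images of the monomials\<close>

lemma fps_mult_compose_nth:
  fixes F G H :: "'a :: comm_ring_1 fps"
  assumes "G $ 0 = 0"
  shows "(H * (F oo G)) $ k = (\<Sum>j\<le>k. F $ j * (H * G ^ j) $ k)"
proof -
  \<comment> \<open>The power G^j has no terms of order below j. The summation range can therefore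
    be extended to j <= k for every i, which permits the exchange of sums.\<close>
  have "(F oo G) $ (k - i) = (\<Sum>j\<le>k. F $ j * (G ^ j) $ (k - i))" for i
    unfolding fps_compose_nth
    by (rule sum.mono_neutral_left) (use startsby_zero_power_prefix[OF assms] in auto)
  then have "(H * (F oo G)) $ k = (\<Sum>i=0..k. \<Sum>j\<le>k. F $ j * (H $ i * (G ^ j) $ (k - i)))"
    by (simp add: fps_mult_nth sum_distrib_left mult_ac)
  also have "\<dots> = (\<Sum>j\<le>k. F $ j * (H * G ^ j) $ k)"
    by (subst sum.swap) (simp add: fps_mult_nth sum_distrib_left)
  finally show ?thesis .
qed

text \<open>Each degree contains a monic Meixner polynomial; subtracting a multiple of it lowers the
  degree, or leaves 0.\<close>

lemma linear_eq_on_meixner_polys: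
  fixes F G :: "complex poly \<Rightarrow> complex poly"
  assumes F: "\<And>p q. F (p + q) = F p + F q" "\<And>c p. F (smult c p) = smult c (F p)"
    and G: "\<And>p q. G (p + q) = G p + G q" "\<And>c p. G (smult c p) = smult c (G p)"
    and eq: "\<And>n. F (meixner_poly \<alpha> \<beta> \<sigma> n) = G (meixner_poly \<alpha> \<beta> \<sigma> n)"
  shows "F p = G p"
proof (induction "degree p" arbitrary: p rule: less_induct)
  case less
  let ?s = "meixner_poly \<alpha> \<beta> \<sigma> (degree p)"
  have s: "degree ?s = degree p" "coeff ?s (degree p) = 1"
    using meixner_poly_degree[of \<alpha> \<beta> \<sigma> "degree p"] by auto
  define q where "q = p - smult (lead_coeff p) ?s"
  have "coeff q (degree p) = 0" by (simp add: q_def s)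
  moreover have "degree q \<le> degree p"
    unfolding q_def by (rule degree_diff_le) (auto simp: s intro: order_trans[OF degree_smult_le])
  ultimately have "q = 0 \<or> degree q < degree p"
    by (metis leading_coeff_0_iff le_neq_implies_less)
  then have "F q = G q"
    using less F(2)[of 0 0] G(2)[of 0 0] by auto
  moreover have "p = q + smult (lead_coeff p) ?s" by (simp add: q_def)
  ultimately show ?case by (metis F G eq)
qed

section \<open>The operator corresponding to multiplication by the variable\<close>

context meixner
begin

text \<open>The expanded form of z(1 + \<alpha> d/dz)(1 + \<beta> d/dz) + \<sigma> d/dz, with
  \<open>pCons 0\<close> as multiplication by z.\<close>

definition A :: "complex poly \<Rightarrow> complex poly" where
  "A p = pCons 0 p + smult (\<alpha> + \<beta>) (pCons 0 (pderiv p)) + smult (of_real \<sigma>) (pderiv p)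
     + smult (\<alpha> * \<beta>) (pCons 0 (pderiv (pderiv p)))"

text \<open>Weighting by \<open>j!\<close> makes the recursion linear in \<open>j\<close>, which is what both the growth bound and
  the generating function use.\<close>

lemma coeff_A:
  "coeff (A p) j * fact j = of_nat j * (coeff p (j - 1) * fact (j - 1)) +
     (\<alpha> + \<beta>) * of_nat j * (coeff p j * fact j) +
     (of_real \<sigma> + \<alpha> * \<beta> * of_nat j) * (coeff p (Suc j) * fact (Suc j))"
  \<comment> \<open>For j = 0 the truncated index j - 1 is harmless, since its term carries the
    factor \<open>of_nat j\<close>.\<close>
  by (cases j) (simp_all add: A_def coeff_pderiv algebra_simps)

primrec q :: "nat \<Rightarrow> complex poly" where
  "q 0 = 1"
| "q (Suc k) = A (q k)"

text \<open>The coefficients are those of \<open>meixner_poly_recurrence\<close>: \<open>A\<close>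
  acts on z^n as multiplication by the variable acts on the n-th Meixner polynomial.\<close>

lemma A_monom:
  "A (monom 1 n) = monom 1 (Suc n) + smult ((\<alpha> + \<beta>) * of_nat n) (monom 1 n)
     + smult (of_real \<sigma> * of_nat n + \<alpha> * \<beta> * of_nat n * (of_nat n - 1)) (monom 1 (n - 1))"
proof (rule poly_eqI)
  fix j
  show "coeff (A (monom 1 n)) j = coeff (monom 1 (Suc n) + smult ((\<alpha> + \<beta>) * of_nat n) (monom 1 n)
     + smult (of_real \<sigma> * of_nat n + \<alpha> * \<beta> * of_nat n * (of_nat n - 1)) (monom 1 (n - 1))) j"
    by (cases n) (auto simp: A_def coeff_pderiv coeff_pCons algebra_simps split: nat.splits)
qed

lemma A_add: "A (p + r) = A p + A r"
  by (rule poly_eqI) (simp add: A_def coeff_pderiv coeff_pCons algebra_simps split: nat.splits)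

lemma A_smult: "A (smult c p) = smult c (A p)"
  by (rule poly_eqI) (simp add: A_def coeff_pderiv coeff_pCons algebra_simps split: nat.splits)

text \<open>Multiplication by the variable corresponds to \<open>A\<close> on the Meixner
  polynomials, hence on all polynomials; iteration starts from the image 1 of the constant
  1.\<close>

lemma operator_monom:
  assumes lin: "Vector_Spaces.linear smult smult S\<^sub>0"
    and S: "\<And>n. S\<^sub>0 (meixner_poly \<alpha> \<beta> (of_real \<sigma>) n) = monom 1 n"
  shows "S\<^sub>0 (monom 1 k) = q k"
proof -
  have add: "S\<^sub>0 (p + r) = S\<^sub>0 p + S\<^sub>0 r" and smult: "S\<^sub>0 (smult c p) = smult c (S\<^sub>0 p)" for p r c
    using lin by (auto simp: Vector_Spaces.linear_iff)
  let ?s = "meixner_poly \<alpha> \<beta> (of_real \<sigma>)"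
  have "S\<^sub>0 ([:0, 1:] * ?s n) = A (S\<^sub>0 (?s n))" for n
    unfolding meixner_poly_recurrence S A_monom add smult ..
  then have "S\<^sub>0 (pCons 0 (?s n)) = A (S\<^sub>0 (?s n))" for n
    by simp
  then have A: "S\<^sub>0 (pCons 0 p) = A (S\<^sub>0 p)" for p
  proof (rule linear_eq_on_meixner_polys[rotated -1])
    show "S\<^sub>0 (pCons 0 (p + r)) = S\<^sub>0 (pCons 0 p) + S\<^sub>0 (pCons 0 r)" for p r
      by (simp flip: add)
    show "S\<^sub>0 (pCons 0 (smult c p)) = smult c (S\<^sub>0 (pCons 0 p))" for c p
      by (simp flip: smult)
  qed (simp_all add: add smult A_add A_smult)
  show ?thesis
  proof (induction k)
    case 0
    then show ?case using S[of 0] by (simp add: monom_0 one_pCons)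
  qed (simp add: monom_Suc A)
qed

lemma degree_q_le: "degree (q k) \<le> k"
proof (induction k)
  case (Suc k)
  show ?case
  proof (rule degree_le, intro allI impI)
    fix j assume j: "j > Suc k"
    then have "coeff (q k) (j - 1) = 0" "coeff (q k) j = 0" "coeff (q k) (Suc j) = 0"
      using Suc by (auto intro!: coeff_eq_0)
    then have "coeff (A (q k)) j * fact j = 0" by (simp only: coeff_A) simp
    then show "coeff (q (Suc k)) j = 0" by simp
  qed
qed auto

text \<open>The three summands are the costs, relative to the weight \<tau>^j, of the terms with
  index j - 1, j and j + 1 in \<open>coeff_A\<close>.\<close>

definition growth :: "real \<Rightarrow> real" where
  "growth \<tau> = 1 / \<tau> + cmod (\<alpha> + \<beta>) + (\<sigma> + \<eta>) * \<tau>"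

lemma growth_pos: "\<tau> > 0 \<Longrightarrow> growth \<tau> > 0"
  using \<sigma>_pos \<eta>_pos by (auto simp: growth_def intro!: add_pos_nonneg)

text \<open>Induction on k through \<open>coeff_A\<close>. Its coefficients are of size j, and j <=
  k + 1 wherever the new coefficient can be nonzero, so each step contributes a factor k + 1 and
  builds up the factorial.\<close>

lemma norm_coeff_q_le:
  assumes \<tau>: "\<tau> > 0"
  shows "cmod (coeff (q k) j * fact j) \<le> fact k * growth \<tau> ^ k * \<tau> ^ j"
proof (induction k arbitrary: j)
  case 0
  then show ?case using \<tau> by (cases j) auto
next
  case (Suc k)
  let ?B = "fact k * growth \<tau> ^ k"
  have B: "?B \<ge> 0" using growth_pos[OF \<tau>] by simp
  show ?case
  proof (cases "j > Suc k")
    case True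
    then have "coeff (q (Suc k)) j = 0" using degree_q_le[of "Suc k"] by (intro coeff_eq_0) auto
    then show ?thesis using growth_pos[OF \<tau>] \<tau> by simp
  next
    case False
    have "cmod (coeff (q (Suc k)) j * fact j) \<le>
        real j * cmod (coeff (q k) (j - 1) * fact (j - 1)) +
        cmod (\<alpha> + \<beta>) * real j * cmod (coeff (q k) j * fact j) +
        cmod (of_real \<sigma> + \<alpha> * \<beta> * of_nat j) * cmod (coeff (q k) (Suc j) * fact (Suc j))"
      unfolding q.simps coeff_A
      by (rule order_trans[OF norm_triangle_ineq] add_mono | simp only: norm_mult norm_of_nat order_refl)+
    also have "cmod (of_real \<sigma> + \<alpha> * \<beta> * of_nat j) = \<sigma> + \<eta> * real j"
    proof -
      have "of_real \<sigma> + \<alpha> * \<beta> * of_nat j = of_real (\<sigma> + \<eta> * real j)" by (simp flip: of_real_\<eta>)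
      then show ?thesis using \<sigma>_pos \<eta>_pos by (simp only: norm_of_real) simp
    qed
    also have "real j * cmod (coeff (q k) (j - 1) * fact (j - 1)) +
        cmod (\<alpha> + \<beta>) * real j * cmod (coeff (q k) j * fact j) +
        (\<sigma> + \<eta> * real j) * cmod (coeff (q k) (Suc j) * fact (Suc j)) \<le>
        real j * (?B * \<tau> ^ (j - 1)) + cmod (\<alpha> + \<beta>) * real j * (?B * \<tau> ^ j) +
        (\<sigma> + \<eta> * real j) * (?B * \<tau> ^ Suc j)"
      using \<sigma>_pos \<eta>_pos by (intro add_mono mult_left_mono Suc) auto
    also have "real j * (?B * \<tau> ^ (j - 1)) = real j * (?B * \<tau> ^ j) * (1 / \<tau>)"
      using \<tau> by (cases j) auto
    \<comment> \<open>Writing \<sigma> as 1 * \<sigma> prepares the termwise comparison, in which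
      both 1 and j are replaced by \<open>Suc k\<close>.\<close>
    also have "real j * (?B * \<tau> ^ j) * (1 / \<tau>) + cmod (\<alpha> + \<beta>) * real j * (?B * \<tau> ^ j) +
        (\<sigma> + \<eta> * real j) * (?B * \<tau> ^ Suc j) =
        ?B * \<tau> ^ j * (real j * (1 / \<tau>) + real j * cmod (\<alpha> + \<beta>) + (1 * \<sigma> + real j * \<eta>) * \<tau>)"
      by (simp add: algebra_simps)
    also have "\<dots> \<le> ?B * \<tau> ^ j * (real (Suc k) * (1 / \<tau>) + real (Suc k) * cmod (\<alpha> + \<beta>) +
        (real (Suc k) * \<sigma> + real (Suc k) * \<eta>) * \<tau>)"
      using False \<tau> \<sigma>_pos \<eta>_pos B by (intro mult_left_mono add_mono mult_right_mono) auto
    also have "\<dots> = ?B * \<tau> ^ j * (real (Suc k) * growth \<tau>)"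
      unfolding growth_def by (simp only: distrib_left distrib_right mult.assoc add.assoc)
    also have "\<dots> = fact (Suc k) * growth \<tau> ^ Suc k * \<tau> ^ j"
      by (simp add: mult_ac)
    finally show ?thesis .
  qed
qed

lemma norm_poly_q_le:
  assumes \<tau>: "\<tau> > 0"
  shows "cmod (poly (q k) z) \<le> fact k * growth \<tau> ^ k * exp (\<tau> * cmod z)"
proof -
  have "cmod (poly (q k) z) \<le> (\<Sum>j\<le>degree (q k). cmod (coeff (q k) j * z ^ j))"
    unfolding poly_altdef by (rule norm_sum)
  also have "\<dots> = (\<Sum>j<Suc (degree (q k)). cmod (coeff (q k) j * fact j) * (cmod z ^ j / fact j))"
    by (simp only: lessThan_Suc_atMost) (simp add: norm_mult norm_power)
  also have "\<dots> \<le> (\<Sum>j<Suc (degree (q k)). fact k * growth \<tau> ^ k * \<tau> ^ j * (cmod z ^ j / fact j))"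
    by (intro sum_mono mult_right_mono norm_coeff_q_le \<tau>) auto
  also have "\<dots> = fact k * growth \<tau> ^ k * (\<Sum>j<Suc (degree (q k)). (\<tau> * cmod z) ^ j /\<^sub>R fact j)"
    by (simp only: sum_distrib_left) (simp add: power_mult_distrib field_simps)
  also have "\<dots> \<le> fact k * growth \<tau> ^ k * exp (\<tau> * cmod z)"
    using \<tau> growth_pos[OF \<tau>] by (intro mult_left_mono sum_exp_series_le) auto
  finally show ?thesis .
qed

text \<open>By the two differential equations, the derivative of H F^j combines H F^(j-1), H F^j and
  H F^(j+1) with exactly the coefficients of \<open>coeff_A\<close>. Both sides thus satisfy the
  same recursion in k.\<close>

lemma coeff_q_fps:
  assumes F0: "F $ 0 = 0" and H0: "H $ 0 = 1"
    and F': "fps_deriv F = (1 + fps_const \<alpha> * F) * (1 + fps_const \<beta> * F)"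
    and H': "fps_deriv H = fps_const (of_real \<sigma>) * F * H"
  shows "coeff (q k) j * fact j = fact k * (H * F ^ j) $ k"
proof (induction k arbitrary: j)
  case 0
  then show ?case using F0 H0 by (cases j) simp_all
next
  case (Suc k)
  have deriv: "fps_deriv (H * F ^ j) =
     of_nat j * (H * F ^ (j - 1)) + fps_const (\<alpha> + \<beta>) * of_nat j * (H * F ^ j)
     + (fps_const (of_real \<sigma>) + fps_const (\<alpha> * \<beta>) * of_nat j) * (H * F ^ Suc j)"
  proof (cases j)
    case (Suc n)
    define c :: "complex fps" where "c = of_nat (Suc n)"
    have "fps_deriv (F ^ Suc n) = c * fps_deriv F * F ^ n"
      unfolding fps_deriv_power by (simp only: c_def fps_of_nat diff_Suc_1)
    then have "fps_deriv (H * F ^ Suc n) = H * (c * ((1 + fps_const \<alpha> * F) * (1 + fps_const \<beta> * F)) * F ^ n) +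
        fps_const (of_real \<sigma>) * F * H * F ^ Suc n"
      by (simp only: fps_deriv_mult F' H')
    then show ?thesis
      unfolding Suc c_def[symmetric] by (simp add: algebra_simps flip: fps_const_mult fps_const_add)
  qed (simp add: H')
  have "fact (Suc k) * (H * F ^ j) $ Suc k = fact k * fps_deriv (H * F ^ j) $ k"
    by (simp del: fps_deriv_mult)
  also have "\<dots> = fact k * (of_nat j * (H * F ^ (j - 1)) $ k + (\<alpha> + \<beta>) * of_nat j * (H * F ^ j) $ k
     + (of_real \<sigma> + \<alpha> * \<beta> * of_nat j) * (H * F ^ Suc j) $ k)"
    unfolding deriv fps_of_nat[symmetric] fps_const_mult fps_const_add fps_add_nth fps_mult_left_const_nth ..
  also have "\<dots> = of_nat j * (coeff (q k) (j - 1) * fact (j - 1)) +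
     (\<alpha> + \<beta>) * of_nat j * (coeff (q k) j * fact j) +
     (of_real \<sigma> + \<alpha> * \<beta> * of_nat j) * (coeff (q k) (Suc j) * fact (Suc j))"
    unfolding Suc by (simp add: algebra_simps)
  also have "\<dots> = coeff (q (Suc k)) j * fact j"
    by (simp only: q.simps coeff_A)
  finally show ?case ..
qed

lemma poly_q_fps:
  assumes "F $ 0 = 0" "H $ 0 = 1"
    and "fps_deriv F = (1 + fps_const \<alpha> * F) * (1 + fps_const \<beta> * F)"
    and "fps_deriv H = fps_const (of_real \<sigma>) * F * H"
  shows "(H * (fps_exp z oo F)) $ k = poly (q k) z / fact k"
proof -
  have "poly (q k) z = (\<Sum>j\<le>k. coeff (q k) j * z ^ j)"
    unfolding poly_altdef
    by (rule sum.mono_neutral_left) (use degree_q_le[of k] in \<open>auto simp: coeff_eq_0\<close>)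
  also have "\<dots> = (\<Sum>j\<le>k. fact k * (H * F ^ j) $ k * (z ^ j / fact j))"
    unfolding coeff_q_fps[OF assms, symmetric] by simp
  finally show ?thesis
    unfolding fps_mult_compose_nth[OF assms(1)]
    by (simp add: sum_divide_distrib mult_ac)
qed

text \<open>Holomorphic extensions of the Laplace transform: \<open>\<Sum> s\<^sub>n t(u)\<^sup>n/n! = e\<^bsup>ux\<^esup> / h(u)\<close> is the
  generating function of the Meixner polynomials, with \<open>u\<close> as parameter instead of \<open>t\<close>.\<close>

definition L :: "complex \<Rightarrow> complex" where
  "L u = exp (- u * of_real (Re \<alpha>)) * of_real (cos \<phi>) / cos (of_real \<phi> + of_real (Im \<alpha>) * u)"

definition t :: "complex \<Rightarrow> complex" where
  "t u = (exp (u * \<beta>) * L u - 1) / \<beta>"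

definition h :: "complex \<Rightarrow> complex" where
  "h u = exp (of_real \<kappa> * Ln (L u))"

section \<open>Differential equations of the holomorphic extensions\<close>

lemma L_0: "L 0 = 1"
proof -
  have "cos (complex_of_real \<phi>) \<noteq> 0" using cos_\<phi>_pos by (simp add: cos_of_real)
  then show ?thesis by (simp add: L_def cos_of_real)
qed

lemma \<alpha>_cos_\<phi>: "\<alpha> * of_real (cos \<phi>) = \<i> * of_real (Im \<alpha>) * exp (- (\<i> * of_real \<phi>))"
proof -
  have "Im \<alpha> = cmod \<alpha> * cos \<phi>" by (subst \<alpha>_polar, simp)
  moreover have "exp (- (\<i> * complex_of_real \<phi>)) = cis (- \<phi>)" by (simp add: cis_conv_exp)
  ultimately show ?thesis by (subst \<alpha>_polar) (simp add: mult_ac)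
qed

text \<open>With v = \<phi> + u Im \<alpha>, the logarithmic derivative of L is Im \<alpha> tan v -
  Re \<alpha>. By \<open>\<alpha>_cos_\<phi>\<close>, \<alpha> e^(u\<beta>) L(u) = Im \<alpha> (tan
  v + i); subtracting \<alpha> gives the same expression.\<close>

lemma log_deriv_L:
  assumes c: "cos (of_real \<phi> + of_real (Im \<alpha>) * u) \<noteq> 0"
  shows "(L has_field_derivative \<alpha> * \<beta> * t u * L u) (at u)"
proof -
  let ?v = "of_real \<phi> + of_real (Im \<alpha>) * u"
  have "u * \<beta> + - u * of_real (Re \<alpha>) = - (\<i> * of_real (Im \<alpha>) * u)"
    by (simp add: complex_eq_iff algebra_simps)
  then have "exp (u * \<beta>) * exp (- u * of_real (Re \<alpha>)) = exp (- (\<i> * of_real (Im \<alpha>) * u))"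
    by (simp only: exp_add[symmetric])
  then have "\<alpha> * (exp (u * \<beta>) * L u) = \<alpha> * of_real (cos \<phi>) * exp (- (\<i> * of_real (Im \<alpha>) * u)) / cos ?v"
    by (simp add: L_def mult_ac)
  also have "\<dots> = \<i> * of_real (Im \<alpha>) * exp (- (\<i> * ?v)) / cos ?v"
  proof -
    have "exp (- (\<i> * of_real \<phi>)) * exp (- (\<i> * of_real (Im \<alpha>) * u)) = exp (- (\<i> * ?v))"
      by (simp add: algebra_simps flip: exp_add)
    then show ?thesis unfolding \<alpha>_cos_\<phi> by (simp only: mult.assoc)
  qed
  also have "\<dots> = of_real (Im \<alpha>) * (sin ?v + \<i> * cos ?v) / cos ?v"
    unfolding exp_minus_Euler by (simp add: algebra_simps)
  also have "\<dots> = of_real (Im \<alpha>) * sin ?v / cos ?v + \<i> * of_real (Im \<alpha>)"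
    using c by (simp add: distrib_left add_divide_distrib)
  finally have "\<alpha> * (exp (u * \<beta>) * L u) - \<alpha> = of_real (Im \<alpha>) * sin ?v / cos ?v - of_real (Re \<alpha>)"
    by (simp add: complex_eq_iff)
  moreover have "\<alpha> * \<beta> * t u = \<alpha> * (exp (u * \<beta>) * L u) - \<alpha>"
  proof -
    have "\<beta> * t u = exp (u * \<beta>) * L u - 1" using \<alpha>_neq_0 by (simp add: t_def)
    then show ?thesis by (simp only: mult.assoc right_diff_distrib mult_1_right)
  qed
  ultimately have "\<alpha> * \<beta> * t u = of_real (Im \<alpha>) * sin ?v / cos ?v - of_real (Re \<alpha>)"
    by simp
  moreover have "(L has_field_derivative (of_real (Im \<alpha>) * sin ?v / cos ?v - of_real (Re \<alpha>)) * L u) (at u)"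
    unfolding L_def[abs_def]
    by (rule derivative_eq_intros refl c | use c in \<open>simp add: field_simps power2_eq_square\<close>)+
  ultimately show ?thesis by simp
qed

text \<open>An open neighbourhood of 0 on which L has no pole and the principal logarithm in
  \<open>h\<close> is holomorphic.\<close>

definition D :: "complex set" where
  "D = {u. cos (of_real \<phi> + of_real (Im \<alpha>) * u) \<noteq> 0} \<inter> L -` (- \<real>\<^sub>\<le>\<^sub>0)"

lemma open_D: "open D"
  unfolding D_def
proof (rule continuous_open_preimage)
  show "open {u. cos (of_real \<phi> + of_real (Im \<alpha>) * u) \<noteq> (0 :: complex)}"
    by (intro open_Collect_neq continuous_intros)
  show "continuous_on {u. cos (of_real \<phi> + of_real (Im \<alpha>) * u) \<noteq> (0 :: complex)} L"
    using log_deriv_L by (intro continuous_at_imp_continuous_on ballI DERIV_isCont) auto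
  show "open (- \<real>\<^sub>\<le>\<^sub>0 :: complex set)" by (intro open_Compl closed_nonpos_Reals_complex)
qed

lemma zero_in_D: "0 \<in> D"
  using cos_\<phi>_pos L_0 by (simp add: D_def cos_of_real)

lemma deriv_L: "u \<in> D \<Longrightarrow> (L has_field_derivative \<alpha> * \<beta> * t u * L u) (at u)"
  by (rule log_deriv_L) (simp add: D_def)

lemma exp_L_eq: "exp (u * \<beta>) * L u = 1 + \<beta> * t u"
  using \<alpha>_neq_0 by (simp add: t_def)

text \<open>Differentiating e^(u\<beta>) L(u) = 1 + \<beta> t(u) with L' = \<alpha> \<beta> t L
  produces the factor \<beta> (1 + \<alpha> t).\<close>

lemma deriv_t: "u \<in> D \<Longrightarrow> (t has_field_derivative (1 + \<alpha> * t u) * (1 + \<beta> * t u)) (at u)"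
proof -
  assume u: "u \<in> D"
  have "((\<lambda>u. (exp (u * \<beta>) * L u - 1) / \<beta>) has_field_derivative
      (exp (u * \<beta>) * \<beta> * L u + \<alpha> * \<beta> * t u * L u * exp (u * \<beta>)) / \<beta>) (at u)"
    by (rule DERIV_cdivide) (rule derivative_eq_intros deriv_L[OF u] refl | simp)+
  also have "(exp (u * \<beta>) * \<beta> * L u + \<alpha> * \<beta> * t u * L u * exp (u * \<beta>)) / \<beta> =
      (1 + \<alpha> * t u) * (exp (u * \<beta>) * L u)"
    using \<alpha>_neq_0 by (simp add: field_simps)
  finally show ?thesis unfolding exp_L_eq[of u] t_def[symmetric] .
qed

text \<open>Here h'/h = \<kappa> L'/L = \<kappa> \<alpha> \<beta> t, and \<kappa> \<alpha> \<beta> =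
  \<sigma>.\<close>

lemma deriv_h: "u \<in> D \<Longrightarrow> (h has_field_derivative of_real \<sigma> * t u * h u) (at u)"
proof -
  assume u: "u \<in> D"
  then have Lu: "L u \<notin> \<real>\<^sub>\<le>\<^sub>0" by (simp add: D_def)
  then have L0: "L u \<noteq> 0" by auto
  have "of_real \<kappa> * (\<alpha> * \<beta>) = complex_of_real \<sigma>"
    using \<eta>_pos unfolding of_real_\<eta>[symmetric] \<kappa>_def by simp
  then have eq: "of_real \<kappa> * (\<alpha> * \<beta> * t u * L u / L u) = of_real \<sigma> * t u"
    using L0 by (simp add: mult.assoc)
  have "((\<lambda>u. exp (of_real \<kappa> * Ln (L u))) has_field_derivative
     exp (of_real \<kappa> * Ln (L u)) * (of_real \<kappa> * (\<alpha> * \<beta> * t u * L u / L u))) (at u)"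
    using L0 Lu by (auto intro!: derivative_eq_intros deriv_L[OF u])
  then show ?thesis unfolding eq h_def[abs_def] by (simp add: mult_ac)
qed

lemma holomorphic_t: "t holomorphic_on D" and holomorphic_h: "h holomorphic_on D"
  unfolding holomorphic_on_open[OF open_D] using deriv_t deriv_h by blast+

text \<open>Both sides, divided by k!, are the coefficients of one power series in u. For the left
  side, \<open>bargmann_exp\<close> gives its sum for small real u only, so the identity theorem is
  needed before coefficients can be compared.\<close>

lemma bargmann_power: "bargmann (\<lambda>w. w ^ k) z = poly (q k) z"
proof -
  define F where "F = fps_expansion t 0"
  define H where "H = fps_expansion h 0"
  have F: "t has_fps_expansion F" unfolding F_def
    by (rule has_fps_expansion_fps_expansion[OF open_D zero_in_D])
       (rule holomorphic_t)
  have H: "h has_fps_expansion H" unfolding H_def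
    by (rule has_fps_expansion_fps_expansion[OF open_D zero_in_D])
       (rule holomorphic_h)
  have ev: "eventually (\<lambda>u. u \<in> D) (nhds 0)"
    using open_D zero_in_D by (rule eventually_nhds_in_open)
  \<comment> \<open>The differential equation holds near 0 and passes to the formal series by
    uniqueness of expansions.\<close>
  have "deriv t has_fps_expansion (1 + fps_const \<alpha> * F) * (1 + fps_const \<beta> * F) \<longleftrightarrow>
     (\<lambda>u. (1 + \<alpha> * t u) * (1 + \<beta> * t u)) has_fps_expansion (1 + fps_const \<alpha> * F) * (1 + fps_const \<beta> * F)"
    by (intro has_fps_expansion_cong refl eventually_mono[OF ev] DERIV_imp_deriv deriv_t)
  moreover have "(\<lambda>u. (1 + \<alpha> * t u) * (1 + \<beta> * t u)) has_fps_expansion (1 + fps_const \<alpha> * F) * (1 + fps_const \<beta> * F)"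
    by (intro fps_expansion_intros F)
  ultimately have F': "fps_deriv F = (1 + fps_const \<alpha> * F) * (1 + fps_const \<beta> * F)"
    using has_fps_expansion_deriv[OF F] fps_expansion_unique_complex by blast
  have "deriv h has_fps_expansion fps_const (of_real \<sigma>) * F * H \<longleftrightarrow>
     (\<lambda>u. of_real \<sigma> * t u * h u) has_fps_expansion fps_const (of_real \<sigma>) * F * H"
    by (intro has_fps_expansion_cong refl eventually_mono[OF ev] DERIV_imp_deriv deriv_h)
  moreover have "(\<lambda>u. of_real \<sigma> * t u * h u) has_fps_expansion fps_const (of_real \<sigma>) * F * H"
    by (intro fps_expansion_intros F H)
  ultimately have H': "fps_deriv H = fps_const (of_real \<sigma>) * F * H"
    using has_fps_expansion_deriv[OF H] fps_expansion_unique_complex by blast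
  have F0: "F $ 0 = 0" and H0: "H $ 0 = 1"
    using has_fps_expansion_imp_0_eq_fps_nth_0[OF F] has_fps_expansion_imp_0_eq_fps_nth_0[OF H]
    by (simp_all add: t_def h_def L_0)
  define G where "G = (\<lambda>u. h u * exp (z * t u))"
  have "((\<lambda>x. exp (z * x)) \<circ> t) has_fps_expansion (fps_exp z oo F)"
    by (intro has_fps_expansion_compose has_fps_expansion_exp F F0)
  then have G: "G has_fps_expansion H * (fps_exp z oo F)"
    unfolding G_def o_def by (intro has_fps_expansion_mult H)
  define P where "P = Abs_fps (\<lambda>k. bargmann (\<lambda>w. w ^ k) z / fact k)"
  have P_sums: "(\<lambda>k. P $ k * of_real u ^ k) sums G (of_real u)" if u: "\<bar>u\<bar> \<le> \<epsilon>" for u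
  proof -
    have "(\<lambda>k. of_real u ^ k / fact k * bargmann (\<lambda>w. w ^ k) z) sums bargmann (\<lambda>w. exp (of_real u * w)) z"
    proof (rule bargmann_power_series[where B = 1])
      show "(\<lambda>k. of_real u ^ k / fact k * w ^ k) sums exp (of_real u * w)" for w :: complex
        using exp_converges[of "of_real u * w"]
        by (simp add: scaleR_conv_of_real power_mult_distrib divide_inverse mult_ac)
      have "(\<lambda>w::complex. exp (of_real u * w)) \<in> borel_measurable borel" by measurable
      then show "(\<lambda>w::complex. exp (of_real u * w)) \<in> borel_measurable borel" .
      show "(\<Sum>k<N. cmod (of_real u ^ k / fact k * w ^ k)) \<le> 1 * exp (\<epsilon> * cmod w)" for w N
      proof -
        have "(\<Sum>k<N. cmod (of_real u ^ k / fact k * w ^ k)) = (\<Sum>k<N. (\<bar>u\<bar> * cmod w) ^ k /\<^sub>R fact k)"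
          by (simp add: norm_mult norm_divide norm_power field_simps)
        also have "\<dots> \<le> exp (\<bar>u\<bar> * cmod w)" by (rule sum_exp_series_le) simp
        also have "\<dots> \<le> exp (\<epsilon> * cmod w)" using u by (simp add: mult_right_mono)
        finally show ?thesis by simp
      qed
    qed
    also have "bargmann (\<lambda>w. exp (of_real u * w)) z = G (of_real u)"
    proof -
      have L: "L (of_real u) = of_real (laplace u)"
        by (simp add: L_def laplace_def exp_of_real cos_of_real
              flip: of_real_mult of_real_minus of_real_add of_real_divide)
      have "h (of_real u) = of_real (laplace u powr \<kappa>)"
        using laplace_pos[OF u] by (simp add: h_def L powr_def Ln_of_real exp_of_real flip: of_real_mult)
      then show ?thesis
        unfolding bargmann_exp[OF u] by (simp add: G_def t_def L)
    qed
    finally show ?thesis by (simp add: P_def mult_ac)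
  qed
  \<comment> \<open>Convergence at the single point \<epsilon> bounds the radius of convergence from
    below.\<close>
  have "summable (\<lambda>k. P $ k * of_real \<epsilon> ^ k)"
    using P_sums[of \<epsilon>] \<epsilon>_pos by (auto simp: sums_iff)
  from conv_radius_geI[OF this] have radius: "fps_conv_radius P \<ge> \<epsilon>"
    using \<epsilon>_pos by (simp add: fps_conv_radius_def)
  obtain r0 where r0: "r0 > 0" "ball 0 r0 \<subseteq> D"
    using open_D zero_in_D open_contains_ball by blast
  \<comment> \<open>Small enough for \<open>G\<close> to be holomorphic on the disc and for the
    series \<open>P\<close> to converge there.\<close>
  define r where "r = min r0 \<epsilon>"
  have r: "r > 0" "ball 0 r \<subseteq> D" "r \<le> \<epsilon>" using r0 \<epsilon>_pos by (auto simp: r_def)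
  have eq: "eval_fps P u = G u" if u: "u \<in> ball 0 r" for u
  proof -
    \<comment> \<open>The two functions agree on the real segment (0, r), which accumulates at 0,
      hence on the whole disc.\<close>
    have "eval_fps P u - G u = 0"
    proof (rule analytic_continuation[where f = "\<lambda>u. eval_fps P u - G u" and w = u and S = "ball 0 r" and U = "of_real ` {0<..<r}" and \<xi> = 0])
      have "ereal (cmod x) < fps_conv_radius P" if "cmod x < r" for x
        using that r by (intro less_le_trans[OF _ radius]) simp
      then have "eval_fps P holomorphic_on ball 0 r"
        by (intro holomorphic_on_eval_fps) (auto simp: in_eball_iff)
      moreover have "t holomorphic_on ball 0 r" "h holomorphic_on ball 0 r"
        using holomorphic_t holomorphic_h r(2) holomorphic_on_subset by blast+
      ultimately show "(\<lambda>u. eval_fps P u - G u) holomorphic_on ball 0 r"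
        unfolding G_def
        by (intro holomorphic_on_diff holomorphic_on_mult holomorphic_on_exp' holomorphic_on_const)
      show "0 islimpt (complex_of_real ` {0<..<r})"
        unfolding islimpt_approachable
      proof (intro allI impI)
        fix e :: real assume "e > 0"
        then show "\<exists>x'\<in>complex_of_real ` {0<..<r}. x' \<noteq> 0 \<and> dist x' 0 < e"
          using r by (intro bexI[of _ "of_real (min (r / 2) (e / 2))"]) (auto simp: min_def)
      qed
      fix w assume "w \<in> complex_of_real ` {0<..<r}"
      then obtain x where x: "w = of_real x" "0 < x" "x < r" by auto
      then show "eval_fps P w - G w = 0"
        using P_sums[of x] r by (simp add: eval_fps_def sums_iff)
    qed (use r u in auto)
    then show ?thesis by simp
  qed
  have "fps_conv_radius P > 0"
    using radius \<epsilon>_pos by (metis ereal_less(2) less_le_trans)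
  then have "eval_fps P has_fps_expansion P" by (rule eval_fps_has_fps_expansion)
  moreover have "eventually (\<lambda>u. u \<in> ball 0 r) (nhds (0::complex))"
    using r by (intro eventually_nhds_in_open) auto
  then have "eval_fps P has_fps_expansion P \<longleftrightarrow> G has_fps_expansion P"
    by (intro has_fps_expansion_cong refl) (auto elim!: eventually_mono simp: eq)
  ultimately have "P = H * (fps_exp z oo F)"
    using G fps_expansion_unique_complex by blast
  then have "P $ k = poly (q k) z / fact k"
    using poly_q_fps[OF F0 H0 F' H'] by simp
  then show ?thesis by (simp add: P_def)
qed

end

section \<open>Entire functions of minimal type\<close>

lemma Emin_norm_bound:
  assumes "f \<in> Emin" "t > 0"
  shows "cmod (f z) \<le> Emin_norm t f * exp (t * cmod z)"
proof -
  have "cmod (f z) * exp (- t * cmod z) \<le> Emin_norm t f"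
    unfolding Emin_norm_def using assms by (intro cSUP_upper) (auto simp: Emin_def)
  then show ?thesis by (simp add: exp_minus field_simps)
qed

lemma Emin_norm_nonneg:
  assumes "f \<in> Emin" "t > 0"
  shows "Emin_norm t f \<ge> 0"
  using Emin_norm_bound[OF assms, of 0] order_trans[OF norm_ge_zero] by fastforce

lemma Emin_norm_le:
  assumes "\<And>z. cmod (f z) \<le> B * exp (t * cmod z)"
  shows "Emin_norm t f \<le> B"
  unfolding Emin_norm_def using assms
  by (intro cSUP_least) (auto simp: exp_minus field_simps)

lemma EminI:
  assumes "f holomorphic_on UNIV"
    and "\<And>t. t > 0 \<Longrightarrow> \<exists>B. \<forall>z. cmod (f z) \<le> B * exp (t * cmod z)"
  shows "f \<in> Emin"
  unfolding Emin_def
proof (intro CollectI conjI allI impI)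
  fix t :: real assume "t > 0"
  then obtain B where B: "cmod (f z) \<le> B * exp (t * cmod z)" for z using assms(2) by blast
  then show "bdd_above (range (\<lambda>z. cmod (f z) * exp (- t * cmod z)))"
    by (intro bdd_aboveI[of _ B]) (auto simp: exp_minus field_simps)
qed fact

lemma Emin_holomorphic: "f \<in> Emin \<Longrightarrow> f holomorphic_on UNIV"
  by (simp add: Emin_def)

lemma Emin_add:
  assumes "f \<in> Emin" "g \<in> Emin"
  shows "(\<lambda>z. f z + g z) \<in> Emin"
proof (rule EminI)
  show "(\<lambda>z. f z + g z) holomorphic_on UNIV"
    using assms by (intro holomorphic_intros Emin_holomorphic)
  fix t :: real assume t: "t > 0"
  have "cmod (f z + g z) \<le> (Emin_norm t f + Emin_norm t g) * exp (t * cmod z)" for z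
    using norm_triangle_mono[OF Emin_norm_bound[OF assms(1) t] Emin_norm_bound[OF assms(2) t]]
    by (simp add: distrib_right)
  then show "\<exists>B. \<forall>z. cmod (f z + g z) \<le> B * exp (t * cmod z)" by blast
qed

lemma Emin_cmult:
  assumes "f \<in> Emin"
  shows "(\<lambda>z. c * f z) \<in> Emin"
proof (rule EminI)
  show "(\<lambda>z. c * f z) holomorphic_on UNIV"
    using assms by (intro holomorphic_intros Emin_holomorphic)
  fix t :: real assume t: "t > 0"
  have "cmod (c * f z) \<le> cmod c * Emin_norm t f * exp (t * cmod z)" for z
    using Emin_norm_bound[OF assms t] by (simp add: norm_mult mult.assoc mult_left_mono)
  then show "\<exists>B. \<forall>z. cmod (c * f z) \<le> B * exp (t * cmod z)" by blast
qed

lemma Emin_diff: "f \<in> Emin \<Longrightarrow> g \<in> Emin \<Longrightarrow> (\<lambda>z. f z - g z) \<in> Emin"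
  using Emin_add[of f "\<lambda>z. - 1 * g z"] Emin_cmult[of g "- 1"] by simp

lemma Emin_norm_triangle:
  assumes "f \<in> Emin" "g \<in> Emin" "t > 0"
  shows "Emin_norm t (\<lambda>z. f z + g z) \<le> Emin_norm t f + Emin_norm t g"
  using norm_triangle_mono[OF Emin_norm_bound[OF assms(1,3)] Emin_norm_bound[OF assms(2,3)]]
  by (intro Emin_norm_le) (simp add: distrib_right)

section \<open>Taylor coefficients of functions of minimal type\<close>

definition taylor :: "(complex \<Rightarrow> complex) \<Rightarrow> nat \<Rightarrow> complex" where
  "taylor f k = (deriv ^^ k) f 0 / fact k"

lemma taylor_sums:
  assumes "f \<in> Emin"
  shows "(\<lambda>k. taylor f k * z ^ k) sums f z"
proof -
  have "f holomorphic_on ball 0 (cmod z + 1)"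
    using Emin_holomorphic[OF assms] holomorphic_on_subset by blast
  from holomorphic_power_series[OF this, of z] show ?thesis by (simp add: taylor_def)
qed

lemma norm_taylor_le:
  assumes f: "f \<in> Emin" and t: "t > 0"
  shows "cmod (taylor f k) \<le> Emin_norm t f * ((exp 1 * t) ^ k / fact k)"
proof (cases "k = 0")
  case True
  then show ?thesis using Emin_norm_bound[OF f t, of 0] by (simp add: taylor_def)
next
  case False
  \<comment> \<open>This radius minimises e^(tr) / r^k; for k = 0 it would be 0, hence the separate
    case.\<close>
  define r where "r = real k / t"
  have r: "r > 0" using False t by (simp add: r_def)
  have hol: "f holomorphic_on UNIV" by (rule Emin_holomorphic[OF f])
  have "cmod ((deriv ^^ k) f 0) \<le> fact k * (Emin_norm t f * exp (t * r)) / r ^ k"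
  proof (rule Cauchy_inequality[OF _ _ r])
    show "f holomorphic_on ball 0 r" using hol holomorphic_on_subset by blast
    show "continuous_on (cball 0 r) f"
      using hol holomorphic_on_imp_continuous_on continuous_on_subset by blast
    show "cmod (f x) \<le> Emin_norm t f * exp (t * r)" if "cmod (0 - x) = r" for x
      using Emin_norm_bound[OF f t, of x] that by simp
  qed
  then have "cmod (taylor f k) \<le> Emin_norm t f * (exp (t * r) / r ^ k)"
    using divide_right_mono[of _ _ "fact k :: real"] by (force simp: taylor_def norm_divide)
  also have "exp (t * r) / r ^ k = (exp 1 * t) ^ k / real k ^ k"
    using t by (simp add: r_def power_mult_distrib power_divide flip: exp_of_nat_mult)
  also have "Emin_norm t f * \<dots> \<le> Emin_norm t f * ((exp 1 * t) ^ k / fact k)"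
  proof -
    have "fact k \<le> real k ^ k" using fact_le_power[of k, where 'a = real] by simp
    then show ?thesis
      using False t Emin_norm_nonneg[OF f t]
      by (intro mult_left_mono divide_left_mono mult_pos_pos) auto
  qed
  finally show ?thesis .
qed

section \<open>The transform on the space \<open>Emin\<close>\<close>

context meixner
begin

lemma Emin_exp_bounded:
  assumes "f \<in> Emin"
  shows "exp_bounded (Emin_norm \<epsilon> f) f"
proof -
  have "continuous_on UNIV f"
    using Emin_holomorphic[OF assms] holomorphic_on_imp_continuous_on by blast
  then show ?thesis
    using Emin_norm_bound[OF assms \<epsilon>_pos] borel_measurable_continuous_onI by (auto simp: exp_bounded_def)
qed

text \<open>Rewrites the transform as a series of polynomials, on which holomorphy and the
  continuity estimates are based.\<close>

lemma bargmann_taylor_sums: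
  assumes f: "f \<in> Emin"
  shows "(\<lambda>k. taylor f k * poly (q k) z) sums bargmann f z"
proof -
  \<comment> \<open>At this rate \<open>norm_taylor_le\<close> bounds the k-th coefficient by a
    constant times \<epsilon>^k / k!.\<close>
  define s where "s = \<epsilon> / exp 1"
  have s: "s > 0" using \<epsilon>_pos by (simp add: s_def)
  have "(\<Sum>k<N. cmod (taylor f k * w ^ k)) \<le> Emin_norm s f * exp (\<epsilon> * cmod w)" for w N
  proof -
    have "(\<Sum>k<N. cmod (taylor f k * w ^ k)) \<le>
        (\<Sum>k<N. Emin_norm s f * ((exp 1 * s) ^ k / fact k) * cmod w ^ k)"
      unfolding norm_mult norm_power
      by (intro sum_mono mult_right_mono norm_taylor_le f s) auto
    also have "\<dots> = Emin_norm s f * (\<Sum>k<N. (\<epsilon> * cmod w) ^ k /\<^sub>R fact k)"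
      unfolding sum_distrib_left by (simp add: s_def power_mult_distrib divide_inverse mult_ac)
    also have "\<dots> \<le> Emin_norm s f * exp (\<epsilon> * cmod w)"
      using \<epsilon>_pos by (intro mult_left_mono sum_exp_series_le Emin_norm_nonneg f s) auto
    finally show ?thesis .
  qed
  from bargmann_power_series[OF taylor_sums[OF f] exp_bounded_measurable[OF Emin_exp_bounded[OF f]] this]
  show ?thesis by (simp add: bargmann_power)
qed

text \<open>Chosen so that e * radius \<tau> * growth \<tau> = 1/2: the factorials in the bounds for
  the Taylor coefficients and for \<open>q k\<close> cancel, and a geometric series of ratio 1/2
  remains.\<close>

definition radius :: "real \<Rightarrow> real" where
  "radius \<tau> = 1 / (2 * exp 1 * growth \<tau>)"

lemma radius_pos: "\<tau> > 0 \<Longrightarrow> radius \<tau> > 0"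
  using growth_pos by (simp add: radius_def)

lemma norm_taylor_mult_q_le:
  assumes f: "f \<in> Emin" and \<tau>: "\<tau> > 0"
  shows "cmod (taylor f k * poly (q k) z) \<le> Emin_norm (radius \<tau>) f * exp (\<tau> * cmod z) * (1 / 2) ^ k"
proof -
  have "cmod (taylor f k * poly (q k) z) \<le>
      Emin_norm (radius \<tau>) f * ((exp 1 * radius \<tau>) ^ k / fact k) * (fact k * growth \<tau> ^ k * exp (\<tau> * cmod z))"
    unfolding norm_mult using radius_pos[OF \<tau>] Emin_norm_nonneg[OF f radius_pos[OF \<tau>]]
    by (intro mult_mono norm_taylor_le norm_poly_q_le f \<tau>) auto
  also have "\<dots> = Emin_norm (radius \<tau>) f * exp (\<tau> * cmod z) * (exp 1 * radius \<tau> * growth \<tau>) ^ k"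
    by (simp add: power_mult_distrib)
  also have "exp 1 * radius \<tau> * growth \<tau> = 1 / 2"
    using growth_pos[OF \<tau>] by (simp add: radius_def)
  finally show ?thesis .
qed

text \<open>Summing the geometric series gives the factor 2. This estimate of one norm by another
  yields both membership in \<open>Emin\<close> and continuity.\<close>

lemma norm_bargmann_le:
  assumes f: "f \<in> Emin" and \<tau>: "\<tau> > 0"
  shows "cmod (bargmann f z) \<le> 2 * Emin_norm (radius \<tau>) f * exp (\<tau> * cmod z)"
proof -
  let ?B = "Emin_norm (radius \<tau>) f * exp (\<tau> * cmod z)"
  have geo: "(\<lambda>k. ?B * (1 / 2) ^ k) sums (?B * (1 / (1 - 1 / 2)))"
    by (intro sums_mult geometric_sums) simp
  have "cmod (\<Sum>k. taylor f k * poly (q k) z) \<le> (\<Sum>k. ?B * (1 / 2) ^ k)"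
    using geo by (intro norm_suminf_le norm_taylor_mult_q_le f \<tau>) (auto simp: sums_iff)
  then show ?thesis
    using geo bargmann_taylor_sums[OF f, of z] by (simp add: sums_iff)
qed

lemma bargmann_holomorphic:
  assumes f: "f \<in> Emin"
  shows "bargmann f holomorphic_on UNIV"
proof (rule holomorphic_uniform_sequence[where f = "\<lambda>n z. \<Sum>k<n. taylor f k * poly (q k) z"])
  fix x :: complex
  \<comment> \<open>The case \<tau> = 1 of the termwise bound, with |z| <= |x| + 1 on the closed
    unit disc about x.\<close>
  let ?M = "\<lambda>k. Emin_norm (radius 1) f * exp (1 * (cmod x + 1)) * (1 / 2) ^ k"
  have "cmod (taylor f k * poly (q k) z) \<le> ?M k" if "z \<in> cball x 1" for k z
  proof -
    have "cmod z \<le> cmod x + 1"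
      using that norm_triangle_ineq2[of z x] by (simp add: dist_norm norm_minus_commute)
    then have "Emin_norm (radius 1) f * exp (1 * cmod z) * (1 / 2) ^ k \<le> ?M k"
      using Emin_norm_nonneg[OF f radius_pos[of 1]] by (intro mult_right_mono mult_left_mono) auto
    then show ?thesis using norm_taylor_mult_q_le[OF f, of 1 k z] by linarith
  qed
  moreover have "summable ?M" by (intro summable_mult summable_geometric) simp
  ultimately have "uniform_limit (cball x 1) (\<lambda>n z. \<Sum>k<n. taylor f k * poly (q k) z)
      (\<lambda>z. \<Sum>k. taylor f k * poly (q k) z) sequentially"
    by (rule Weierstrass_m_test)
  moreover have "(\<lambda>z. \<Sum>k. taylor f k * poly (q k) z) = bargmann f"
    using bargmann_taylor_sums[OF f] by (auto simp: sums_iff)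
  ultimately show "\<exists>d>0. cball x d \<subseteq> UNIV \<and>
      uniform_limit (cball x d) (\<lambda>n z. \<Sum>k<n. taylor f k * poly (q k) z) (bargmann f) sequentially"
    by (intro exI[of _ 1]) auto
qed (auto intro!: holomorphic_intros)

lemma bargmann_Emin:
  assumes "f \<in> Emin"
  shows "bargmann f \<in> Emin"
  by (rule EminI[OF bargmann_holomorphic[OF assms]]) (use norm_bargmann_le[OF assms] in blast)

lemma Emin_norm_bargmann_le:
  assumes "f \<in> Emin" "\<tau> > 0"
  shows "Emin_norm \<tau> (bargmann f) \<le> 2 * Emin_norm (radius \<tau>) f"
  using norm_bargmann_le[OF assms] by (intro Emin_norm_le)

lemma bargmann_Emin_add: "f \<in> Emin \<Longrightarrow> g \<in> Emin \<Longrightarrow> bargmann (\<lambda>z. f z + g z) = (\<lambda>z. bargmann f z + bargmann g z)"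
  using bargmann_add[OF Emin_exp_bounded Emin_exp_bounded] by blast

lemma bargmann_Emin_diff:
  assumes "f \<in> Emin" "g \<in> Emin"
  shows "bargmann (\<lambda>z. f z - g z) = (\<lambda>z. bargmann f z - bargmann g z)"
  using bargmann_Emin_add[OF assms(1) Emin_cmult[OF assms(2), of "- 1"]]
    bargmann_cmult[of "- 1" g] by (simp add: fun_eq_iff)

lemma linear_on_Emin_bargmann: "linear_on_Emin bargmann"
  using bargmann_Emin bargmann_Emin_add bargmann_cmult by (auto simp: linear_on_Emin_def)

text \<open>It suffices to treat preimages of the generating balls. Around each point g of such a
  preimage, a ball for the norm with index \<open>radius \<tau>\<close> is contained in it.\<close>

lemma continuous_map_bargmann: "continuous_map Emin_topology Emin_topology bargmann"
proof -
  have "openin Emin_topology (bargmann -` {g \<in> Emin. Emin_norm \<tau> (\<lambda>z. g z - f z) < e} \<inter> Emin)"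
    (is "openin _ ?V") if f: "f \<in> Emin" and \<tau>: "\<tau> > 0" for f \<tau> e
  proof (subst openin_subopen, intro ballI)
    fix g assume g: "g \<in> ?V"
    define \<delta> where "\<delta> = e - Emin_norm \<tau> (\<lambda>z. bargmann g z - f z)"
    have \<delta>: "\<delta> > 0" and gE: "g \<in> Emin" using g by (auto simp: \<delta>_def)
    \<comment> \<open>Half of the slack \<open>\<delta>\<close> compensates for the factor 2 in
      \<open>Emin_norm_bargmann_le\<close>.\<close>
    define W where "W = {g' \<in> Emin. Emin_norm (radius \<tau>) (\<lambda>z. g' z - g z) < \<delta> / 2}"
    have "openin Emin_topology W"
      unfolding Emin_topology_def W_def
      using gE \<delta> radius_pos[OF \<tau>]
      by (intro topology_generated_by_Basis CollectI exI[of _ g] exI[of _ "radius \<tau>"] exI[of _ "\<delta> / 2"]) auto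
    moreover have "g \<in> W"
      using gE \<delta> by (simp add: W_def Emin_norm_def)
    moreover have "W \<subseteq> ?V"
    proof
      fix g' assume "g' \<in> W"
      then have g': "g' \<in> Emin" and lt: "Emin_norm (radius \<tau>) (\<lambda>z. g' z - g z) < \<delta> / 2"
        by (auto simp: W_def)
      have "Emin_norm \<tau> (\<lambda>z. bargmann g' z - f z) = Emin_norm \<tau> (\<lambda>z. bargmann (\<lambda>z. g' z - g z) z + (bargmann g z - f z))"
        by (simp add: bargmann_Emin_diff[OF g' gE])
      also have "\<dots> \<le> Emin_norm \<tau> (bargmann (\<lambda>z. g' z - g z)) + Emin_norm \<tau> (\<lambda>z. bargmann g z - f z)"
        by (intro Emin_norm_triangle bargmann_Emin Emin_diff g' gE f \<tau>)
      also have "\<dots> < \<delta> + Emin_norm \<tau> (\<lambda>z. bargmann g z - f z)"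
        using Emin_norm_bargmann_le[OF Emin_diff[OF g' gE] \<tau>] lt by simp
      finally show "g' \<in> ?V" using g' bargmann_Emin by (simp add: \<delta>_def)
    qed
    ultimately show "\<exists>W. openin Emin_topology W \<and> g \<in> W \<and> W \<subseteq> ?V" by blast
  qed
  moreover have "bargmann ` Emin \<subseteq> \<Union> {{g \<in> Emin. Emin_norm t (\<lambda>z. g z - f z) < e} | f t e.
      f \<in> Emin \<and> t > 0 \<and> e > 0}"
    using bargmann_Emin topspace_Emin_topology
    unfolding Emin_topology_def topology_generated_by_topspace by blast
  ultimately have "continuous_map Emin_topology (topology_generated_by
      {{g \<in> Emin. Emin_norm t (\<lambda>z. g z - f z) < e} | f t e. f \<in> Emin \<and> t > 0 \<and> e > 0}) bargmann"
    by (intro continuous_on_generated_topo) (auto simp: topspace_Emin_topology)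
  then show ?thesis by (simp only: Emin_topology_def[symmetric])
qed

text \<open>Both operators are linear on polynomials and send z^k to \<open>q k\<close>, by
  \<open>bargmann_power\<close> and \<open>operator_monom\<close>.\<close>

lemma bargmann_poly:
  assumes lin: "Vector_Spaces.linear smult smult S\<^sub>0"
    and S: "\<And>n. S\<^sub>0 (meixner_poly \<alpha> \<beta> (of_real \<sigma>) n) = monom 1 n"
  shows "bargmann (poly p) = poly (S\<^sub>0 p)"
proof
  fix z
  have add: "S\<^sub>0 (p + r) = S\<^sub>0 p + S\<^sub>0 r" and smult: "S\<^sub>0 (smult c p) = smult c (S\<^sub>0 p)" for p r c
    using lin by (auto simp: Vector_Spaces.linear_iff)
  have "S\<^sub>0 (\<Sum>k<N. smult (c k) (monom 1 k)) = (\<Sum>k<N. smult (c k) (q k))" for N c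
    using smult[of 0 0] by (induction N) (simp_all add: add smult operator_monom[OF lin S])
  moreover have "(\<Sum>k<Suc (degree p). smult (coeff p k) (monom 1 k)) = p"
    unfolding lessThan_Suc_atMost by (simp add: smult_monom poly_as_sum_of_monoms)
  ultimately have "S\<^sub>0 p = (\<Sum>k<Suc (degree p). smult (coeff p k) (q k))" by metis
  then have "poly (S\<^sub>0 p) z = (\<Sum>k<Suc (degree p). coeff p k * poly (q k) z)"
    by (simp only: poly_sum poly_smult)
  moreover have "poly p = (\<lambda>w. \<Sum>k<Suc (degree p). coeff p k * w ^ k)"
    unfolding lessThan_Suc_atMost by (simp add: fun_eq_iff poly_altdef)
  then have "bargmann (poly p) z = (\<Sum>k<Suc (degree p). coeff p k * poly (q k) z)"
    by (simp only: bargmann_polynomial bargmann_power)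
  ultimately show "bargmann (poly p) z = poly (S\<^sub>0 p) z" by simp
qed

end

theorem theorem3p4:
  fixes \<alpha> \<beta> :: complex and \<sigma> \<eta> :: real
    and S\<^sub>0 :: "complex poly \<Rightarrow> complex poly"
  assumes "\<sigma> > 0" and "Re \<alpha> \<ge> 0" and "Im \<alpha> > 0"
    and "\<beta> = cnj \<alpha>" and "of_real \<eta> = \<alpha> * \<beta>"
    and "Vector_Spaces.linear smult smult S\<^sub>0"
    and "\<And>n. S\<^sub>0 (meixner_poly \<alpha> \<beta> (of_real \<sigma>) n) = monom 1 n"
  shows "\<exists>S :: (complex \<Rightarrow> complex) \<Rightarrow> (complex \<Rightarrow> complex).
    (\<forall>p. S (poly p) = poly (S\<^sub>0 p)) \<and>
    linear_on_Emin S \<and>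
    continuous_map Emin_topology Emin_topology S \<and>
    (\<forall>f\<in>Emin. \<forall>z.
      (\<forall>n::nat. integrable (meixner_measure \<alpha> \<beta> (\<eta> * real n + \<sigma>))
                  (\<lambda>x. f (of_real x + \<beta> * of_nat n))) \<and>
      cpoisson_integrable (z / \<beta>)
        (\<lambda>n. \<integral>x. f (of_real x + \<beta> * of_nat n) \<partial>meixner_measure \<alpha> \<beta> (\<eta> * real n + \<sigma>)) \<and>
      S f z = cpoisson_integral (z / \<beta>)
        (\<lambda>n. \<integral>x. f (of_real x + \<beta> * of_nat n) \<partial>meixner_measure \<alpha> \<beta> (\<eta> * real n + \<sigma>))) \<and>
    (\<forall>f\<in>Emin. \<forall>r::real. r > 0 \<longrightarrow>
      S f (\<beta> * of_real r) = cpoisson_integral (of_real r)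
        (\<lambda>n. \<integral>x. f (of_real x + \<beta> * of_nat n) \<partial>meixner_measure \<alpha> \<beta> (\<eta> * real n + \<sigma>)))"
proof -
  interpret meixner \<alpha> \<sigma> by unfold_locales fact+
  have \<beta>: "\<beta> = cnj \<alpha>" by fact
  have \<eta>: "\<eta> = meixner.\<eta> \<alpha>"
    using assms(5) of_real_\<eta> unfolding \<beta> by (metis of_real_eq_iff)
  have bargmann: "bargmann f z = cpoisson_integral (z / \<beta>)
        (\<lambda>n. \<integral>x. f (of_real x + \<beta> * of_nat n) \<partial>meixner_measure \<alpha> \<beta> (\<eta> * real n + \<sigma>))" for f z
    unfolding bargmann_def fibre_integral_def \<beta> \<eta> ..
  show ?thesis
  proof (intro exI[of _ bargmann] conjI ballI allI impI)
    show "bargmann (poly p) = poly (S\<^sub>0 p)" for p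
      using bargmann_poly[OF assms(6)] assms(7) unfolding \<beta> by blast
    show "linear_on_Emin bargmann" by (rule linear_on_Emin_bargmann)
    show "continuous_map Emin_topology Emin_topology bargmann" by (rule continuous_map_bargmann)
    fix f z assume f: "f \<in> Emin"
    show "integrable (meixner_measure \<alpha> \<beta> (\<eta> * real n + \<sigma>)) (\<lambda>x. f (of_real x + \<beta> * of_nat n))" for n
      unfolding \<beta> \<eta> by (rule exp_bounded_integrable[OF Emin_exp_bounded[OF f]])
    show "cpoisson_integrable (z / \<beta>)
        (\<lambda>n. \<integral>x. f (of_real x + \<beta> * of_nat n) \<partial>meixner_measure \<alpha> \<beta> (\<eta> * real n + \<sigma>))"
      using exp_bounded_cpoisson_integrable[OF Emin_exp_bounded[OF f]] unfolding fibre_integral_def \<beta> \<eta> .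
  \<comment> \<open>What is left is the formula and its case z = \<beta> r, where division by the
    nonzero \<beta> returns the Poisson parameter r.\<close>
  qed (use \<beta> \<alpha>_neq_0 in \<open>simp_all add: bargmann\<close>)
qed

end
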